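(* Consider the stationary decision model with zero terminal cost described in the context and suppose that: (M1) the state space is $E=\mathbb R$; (M2) the sets $D(x)$ are compact, and $\mathbb R\ni x\mapsto D(x)$ is upper semicontinuous (if $x_k\to x$ and $a_k\in D(x_k)$, then $(a_k)$ has an accumulation point in $D(x)$) and decreasing, i.e. $D(x)\supseteq D(y)$ for $x\le y$; (M3) for every $z\in\mathcal Z$ the transition function $T(x,a,z)$ is lower semicontinuous in $(x,a)$ and increasing in $x$; (M4) the one-stage cost function $c(x,a,x')$ is lower semicontinuous in $(x,a,x')$ and increasing in $(x,x')$. Then the following hold. a) (Finite horizon $N\in\mathbb N$.) Assume: (i) there exist $\underline\epsilon,\bar\epsilon\ge0$ with $\underline\epsilon+\bar\epsilon=1$ and measurable $\underline{\mathbf b}:\mathbb R\to(-\infty,-\underline\epsilon]$, $\bar{\mathbf b}:\mathbb R\to[\bar\epsilon,\infty)$ with $\underline{\mathbf b}(x_n)\le V_{n\pi}(h_n)\le\bar{\mathbf b}(x_n)$ for all $\pi\in\Pi$, $n=0,\dots,N$, $h_n\in\mathcal H_n$; (ii) with $\mathbf b=\bar{\mathbf b}-\underline{\mathbf b}$, for all $(\bar x,\bar a)\in D$ there exist $\epsilon>0$ and measurable $\Theta_1^{\bar x,\bar a},\Theta_2^{\bar x,\bar a}:\mathcal Z\to\mathbb R_+$ with $\Theta_1^{\bar x,\bar a}(Z),\Theta_2^{\bar x,\bar a}(Z)\in L^p$ and $|c(x,a,T(x,a,z))|\le\Theta_1^{\bar x,\bar a}(z)$, $\mathbf b(T(x,a,z))\le\Theta_2^{\bar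 x,\bar a}(z)$ for all $z\in\mathcal Z$ and all $(x,a)\in D$ in the closed $\epsilon$-ball around $(\bar x,\bar a)$ (w.r.t. a product metric on $\mathbb R\times A$); (iii) the monetary risk measure $\rho:L^p\to\bar{\mathbb R}$ is law invariant and has the Fatou property. Then for $n=0,\dots,N$ we have $V_n(h_n)=J_n^{(N)}(x_n)$ for all $h_n\in\mathcal H_n$; the function $J_n^{(N)}$ is lower semicontinuous and increasing with $\underline{\mathbf b}\le J_n^{(N)}\le\bar{\mathbf b}$; $J_N^{(N)}=0$ and $J_n^{(N)}=\mathcal TJ_{n+1}^{(N)}$ for $n=0,\dots,N-1$; there exist Markov decision rules $d_n^*$ with $\mathcal TJ_{n+1}^{(N)}=\mathcal T_{d_n^*}J_{n+1}^{(N)}$, and every sequence of such minimizers constitutes an optimal policy $\pi^*=(d_0^*,\dots,d_{N-1}^* )$, i.e. $V_{0\pi^*}(x)=\inf_{\pi\in\Pi}V_{0\pi}(x)$ for all $x$. b) (Infinite horizon.) Assume: (i) there exist $\alpha,\underline\epsilon,\bar\epsilon\ge0$ with $\underline\epsilon+\bar\epsilon=1$ and measurable $\underline b:\mathbb R\to(-\infty,-\underline\epsilon]$, $\bar b:\mathbb R\to[\bar\epsilon,\infty)$ such that for all $(x,a)\in D$: $\underline b(x)\le\rho(c(x,a,T(x,a,Z)))\le\bar b(x)$, $\rho(-\underline b(T(x,a,Z)))\le-\alpha\underline b(x)$ and $\rho(\bar b(T(x,a,Z)))\le\alpha\bar b(x)$; (ii) condition (ii) of a) holds with $\mathbf b$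 replaced by $b=\bar b-\underline b$; (iii) $\rho:L^p\to\bar{\mathbb R}$ is law invariant, proper, coherent and has the Fatou property; (iv) $\alpha\beta<1$. Put $\underline{\mathbf b}=\frac{1}{1-\alpha\beta}\underline b$, $\bar{\mathbf b}=\frac1{1-\alpha\beta}\bar b$ and let $I$ be the set of lower semicontinuous increasing functions $v:\mathbb R\to\mathbb R$ with $\underline{\mathbf b}\le v\le\bar{\mathbf b}$. Then the limit value function $J$ is the unique fixed point of $\mathcal T$ in $I$ (in particular $J$ is increasing); there exists a Markov decision rule $d^*$ with $\mathcal T_{d^*}J=\mathcal TJ$; and each stationary policy $\pi^*=(d^*,d^*,\dots)$ induced by such a $d^*$ satisfies $J_{\infty\pi^*}=J_\infty$, where $J_\infty=\inf_{\pi\in\Pi^M}J_{\infty\pi}$, and $J_\infty=J$.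
   Context: "Increasing" and "decreasing" are meant in the weak sense. Risk measures. Fix a probability space $(\Omega,\mathcal A,\mathbb P)$ and $p\in[1,\infty)$; $L^p=L^p(\Omega,\mathcal A,\mathbb P)$. A risk measure is a map $\rho:L^p\to\bar{\mathbb R}=[-\infty,\infty]$. Monetary: monotone ($X\le Y\Rightarrow\rho(X)\le\rho(Y)$) and translation invariant ($\rho(X+m)=\rho(X)+m$, $m\in\mathbb R$). Coherent: monetary, positive homogeneous ($\rho(\lambda X)=\lambda\rho(X)$ for $\lambda\in\mathbb R_+$) and subadditive. Proper: never $-\infty$ and $<+\infty$ at at least one point. Law invariant: $\rho(X)=\rho(Y)$ whenever $X,Y$ have the same distribution. Fatou property: for $(X_n)\subseteq L^p$ with $|X_n|\le Y$ a.s., $Y\in L^p$, and $X_n\to X\in L^p$ a.s., $\liminf_n\rho(X_n)\ge\rho(X)$. Stationary decision model. Action space $A$ is a Borel space (Borel subset of a Polish space), state space $E$ (here $\mathbb R$); $D\subseteq E\times A$ is measurable and contains the graph of a measurable map $E\to A$; $D(x)=\{a:(x,a)\in D\}$; $T:D\times\mathcal Z\to E$ is a measurable transition function; the disturbances are i.i.d. random elements on $(\Omega,\mathcal A,\mathbb P)$ with values in a measurable space $(\mathcal Z,\mathfrak Z)$, with representative $Z$; $c:D\times E\to\mathbb R$ is the one-stage cost; $\beta\in(0,1]$ is the discount factor; terminal cost is zero. Policies. $\mathcal H_n$ is the set of histories $h_n=(x_0,a_0,x_1,\dots,a_{n-1},x_n)$ with $a_k\in D(x_k)$. A decision rule at time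 $n$ is a measurable $d_n:\mathcal H_n\to A$ with $d_n(h_n)\in D(x_n)$; it is Markov if it depends only on $x_n$. $\Pi$ denotes the set of all ($N$-stage or infinite-stage) policies, i.e. sequences of decision rules, $\Pi^M$ the subset of Markov policies. Operators. $\mathcal T_dv(x)=\rho\big(c(x,d(x),T(x,d(x),Z))+\beta v(T(x,d(x),Z))\big)$ for a Markov decision rule $d$, and $\mathcal Tv(x)=\inf_{a\in D(x)}\rho\big(c(x,a,T(x,a,Z))+\beta v(T(x,a,Z))\big)$, for measurable $v$ bounded in absolute value by a multiple of $\mathbf b$ (resp. $b$). Finite horizon values. $V_{N\pi}=0$ and, with $a=d_n(h_n)$, $V_{n\pi}(h_n)=\rho\big(c(x_n,a,T(x_n,a,Z))+\beta V_{n+1\,\pi}(h_n,a,T(x_n,a,Z))\big)$; $V_n(h_n)=\inf_{\pi\in\Pi}V_{n\pi}(h_n)$. For Markov $\pi$, $V_{n\pi}$ depends only on $x_n$, and $J_n^{(N)}(x)=\inf_{\pi\in\Pi^M}V_{n\pi}(x)$. Infinite horizon values. For $\pi=(d_0,d_1,\dots)\in\Pi^M$: $J_{N\pi}=\mathcal T_{d_0}\circ\dots\circ\mathcal T_{d_{N-1}}0$, $J_N=\inf_{\pi\in\Pi^M}J_{N\pi}$, $J_{\infty\pi}=\lim_NJ_{N\pi}$, $J_\infty=\inf_{\pi\in\Pi^M}J_{\infty\pi}$, $J=\lim_NJ_N$ (pointwise limits, which exist under the assumptions of b)). It is assumed throughout that $\rho$ is such that all policy values are measurable functions. *)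

theory Defs
  imports "HOL-Probability.Probability"
begin

section \<open>Risk measures on $L^p$\<close>

text \<open>Elements of $L^p$ are represented by real-valued functions; inequalities between them are
  read almost surely, so that a monotone functional automatically identifies a.s. equal functions.
  Values of a functional outside \<open>Lp M p\<close> are never constrained.\<close>

definition Lp :: "'w measure \<Rightarrow> real \<Rightarrow> ('w \<Rightarrow> real) set" where
  "Lp M p = {X \<in> borel_measurable M. integrable M (\<lambda>w. \<bar>X w\<bar> powr p)}"

type_synonym 'w risk_measure = "('w \<Rightarrow> real) \<Rightarrow> ereal"

definition monetary :: "'w measure \<Rightarrow> real \<Rightarrow> 'w risk_measure \<Rightarrow> bool" where
  "monetary M p \<rho> \<longleftrightarrow>
     (\<forall>X\<in>Lp M p. \<forall>Y\<in>Lp M p. (AE w in M. X w \<le> Y w) \<longrightarrow> \<rho> X \<le> \<rho> Y) \<and>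
     (\<forall>X\<in>Lp M p. \<forall>t::real. \<rho> (\<lambda>w. X w + t) = \<rho> X + ereal t)"

definition coherent :: "'w measure \<Rightarrow> real \<Rightarrow> 'w risk_measure \<Rightarrow> bool" where
  "coherent M p \<rho> \<longleftrightarrow> monetary M p \<rho> \<and>
     (\<forall>X\<in>Lp M p. \<forall>l\<ge>0. \<rho> (\<lambda>w. l * X w) = ereal l * \<rho> X) \<and>
     (\<forall>X\<in>Lp M p. \<forall>Y\<in>Lp M p. \<rho> (\<lambda>w. X w + Y w) \<le> \<rho> X + \<rho> Y)"

definition proper :: "'w measure \<Rightarrow> real \<Rightarrow> 'w risk_measure \<Rightarrow> bool" where
  "proper M p \<rho> \<longleftrightarrow> (\<forall>X\<in>Lp M p. \<rho> X \<noteq> -\<infinity>) \<and> (\<exists>X\<in>Lp M p. \<rho> X < \<infinity>)"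

definition law_invariant :: "'w measure \<Rightarrow> real \<Rightarrow> 'w risk_measure \<Rightarrow> bool" where
  "law_invariant M p \<rho> \<longleftrightarrow>
     (\<forall>X\<in>Lp M p. \<forall>Y\<in>Lp M p. distr M borel X = distr M borel Y \<longrightarrow> \<rho> X = \<rho> Y)"

definition Fatou_property :: "'w measure \<Rightarrow> real \<Rightarrow> 'w risk_measure \<Rightarrow> bool" where
  "Fatou_property M p \<rho> \<longleftrightarrow>
     (\<forall>X Y X0. (\<forall>n. X n \<in> Lp M p) \<longrightarrow> Y \<in> Lp M p \<longrightarrow> X0 \<in> Lp M p \<longrightarrow>
        (\<forall>n::nat. AE w in M. \<bar>X n w\<bar> \<le> Y w) \<longrightarrow> (AE w in M. (\<lambda>n. X n w) \<longlonglongrightarrow> X0 w) \<longrightarrow>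
        \<rho> X0 \<le> liminf (\<lambda>n. \<rho> (X n)))"

section \<open>Semicontinuity\<close>

definition lsc_on :: "'b::metric_space set \<Rightarrow> ('b \<Rightarrow> ereal) \<Rightarrow> bool" where
  "lsc_on S f \<longleftrightarrow>
     (\<forall>x\<in>S. \<forall>u. (\<forall>k. u k \<in> S) \<longrightarrow> u \<longlonglongrightarrow> x \<longrightarrow> f x \<le> liminf (\<lambda>k. f (u k)))"

definition usc_correspondence :: "('b::metric_space \<Rightarrow> 'a::metric_space set) \<Rightarrow> bool" where
  "usc_correspondence G \<longleftrightarrow>
     (\<forall>x u a. u \<longlonglongrightarrow> x \<longrightarrow> (\<forall>k. a k \<in> G (u k)) \<longrightarrow>
        (\<exists>l\<in>G x. \<exists>r. strict_mono r \<and> (a \<circ> r) \<longlonglongrightarrow> l))"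

section \<open>The stationary decision model with state space \<open>\<real>\<close>\<close>

text \<open>The action space is the Borel subset \<open>actions m\<close> of a Polish space. The functions
  \<open>trans m\<close> and \<open>cost m\<close> are total, but only their values at \<open>(x, a) \<in> adm m\<close> matter.
  \<open>disturbance m n\<close> drives the transition from time \<open>n\<close> to time \<open>Suc n\<close>, and
  \<open>rep m\<close> is the representative of the common law.\<close>

record ('w, 'z, 'a) decision_model =
  prob :: "'w measure"
  noise :: "'z measure"
  disturbance :: "nat \<Rightarrow> 'w \<Rightarrow> 'z"
  rep :: "'w \<Rightarrow> 'z"
  actions :: "'a set"
  adm :: "(real \<times> 'a) set"
  trans :: "real \<Rightarrow> 'a \<Rightarrow> 'z \<Rightarrow> real"
  cost :: "real \<Rightarrow> 'a \<Rightarrow> real \<Rightarrow> real"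
  discount :: real

definition adm_at :: "('w, 'z, 'a) decision_model \<Rightarrow> real \<Rightarrow> 'a set" where
  "adm_at m x = {a. (x, a) \<in> adm m}"

definition stationary_model :: "('w, 'z, 'a::polish_space) decision_model \<Rightarrow> bool" where
  "stationary_model m \<longleftrightarrow>
     prob_space (prob m) \<and>
     rep m \<in> prob m \<rightarrow>\<^sub>M noise m \<and>
     actions m \<in> sets borel \<and>
     adm m \<in> sets borel \<and>
     adm m \<subseteq> UNIV \<times> actions m \<and>
     (\<exists>f \<in> borel \<rightarrow>\<^sub>M borel. \<forall>x. (x, f x) \<in> adm m) \<and>
     (\<lambda>((x, a), z). trans m x a z) \<in> restrict_space borel (adm m) \<Otimes>\<^sub>M noise m \<rightarrow>\<^sub>M borel \<and>
     0 < discount m \<and> discount m \<le> 1"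

text \<open>The horizon \<open>N\<close> is finite or infinite; only the stages before it carry disturbances
  and decision rules.\<close>

definition iid_disturbances :: "('w, 'z, 'a) decision_model \<Rightarrow> enat \<Rightarrow> bool" where
  "iid_disturbances m N \<longleftrightarrow>
     prob_space.indep_vars (prob m) (\<lambda>_. noise m) (disturbance m) {n. enat n < N} \<and>
     (\<forall>n. enat n < N \<longrightarrow>
        distr (prob m) (noise m) (disturbance m n) = distr (prob m) (noise m) (rep m))"

section \<open>Histories and policies\<close>

text \<open>A history $(x_0,a_0,\ldots,x_{n-1},a_{n-1},x_n)$ is the pair of the function
  $k \mapsto (x_k,a_k)$ on \<open>{..<n}\<close> (undefined elsewhere) and the current state $x_n$.\<close>

type_synonym 'a history = "(nat \<Rightarrow> real \<times> 'a) \<times> real"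

definition hist_space ::
    "('w, 'z, 'a::polish_space) decision_model \<Rightarrow> nat \<Rightarrow> 'a history measure" where
  "hist_space m n = (\<Pi>\<^sub>M k\<in>{..<n}. restrict_space borel (adm m)) \<Otimes>\<^sub>M borel"

definition extend_hist :: "nat \<Rightarrow> 'a history \<Rightarrow> 'a \<Rightarrow> real \<Rightarrow> 'a history" where
  "extend_hist n h a x' = ((fst h)(n := (snd h, a)), x')"

definition decision_rules ::
    "('w, 'z, 'a::polish_space) decision_model \<Rightarrow> nat \<Rightarrow> ('a history \<Rightarrow> 'a) set" where
  "decision_rules m n =
     {d \<in> hist_space m n \<rightarrow>\<^sub>M borel. \<forall>h\<in>space (hist_space m n). d h \<in> adm_at m (snd h)}"

definition policies ::
    "('w, 'z, 'a::polish_space) decision_model \<Rightarrow> enat \<Rightarrow> (nat \<Rightarrow> 'a history \<Rightarrow> 'a) set" where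
  "policies m N = {\<pi>. \<forall>n. enat n < N \<longrightarrow> \<pi> n \<in> decision_rules m n}"

text \<open>A Markov decision rule is represented by the map through which it factors.\<close>

definition markov_rules :: "('w, 'z, 'a::polish_space) decision_model \<Rightarrow> (real \<Rightarrow> 'a) set" where
  "markov_rules m = {d \<in> borel \<rightarrow>\<^sub>M borel. \<forall>x. d x \<in> adm_at m x}"

definition markov_policies ::
    "('w, 'z, 'a::polish_space) decision_model \<Rightarrow> enat \<Rightarrow> (nat \<Rightarrow> real \<Rightarrow> 'a) set" where
  "markov_policies m N = {d. \<forall>n. enat n < N \<longrightarrow> d n \<in> markov_rules m}"

definition as_policy :: "(nat \<Rightarrow> real \<Rightarrow> 'a) \<Rightarrow> nat \<Rightarrow> 'a history \<Rightarrow> 'a" where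
  "as_policy d n h = d n (snd h)"

lemma as_policy_in_policies:
  assumes "d \<in> markov_policies m N"
  shows "as_policy d \<in> policies m N"
proof -
  have "as_policy d n \<in> decision_rules m n" if "enat n < N" for n
  proof -
    have d: "d n \<in> borel \<rightarrow>\<^sub>M borel" "\<And>x. d n x \<in> adm_at m x"
      using assms that by (auto simp: markov_policies_def markov_rules_def)
    have "snd \<in> hist_space m n \<rightarrow>\<^sub>M borel"
      unfolding hist_space_def by (rule measurable_snd)
    then have "as_policy d n \<in> hist_space m n \<rightarrow>\<^sub>M borel"
      unfolding as_policy_def using d(1) by (rule measurable_compose)
    then show ?thesis
      unfolding decision_rules_def as_policy_def using d(2) by blast
  qed
  then show ?thesis unfolding policies_def by blast
qed

section \<open>Operators and values\<close>

text \<open>Risk measures may take infinite values, hence so may value functions a priori. In all uses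
  below the boundedness hypotheses make \<open>v\<close> finite, so that \<open>real_of_ereal\<close>
  is merely a coercion.\<close>

definition stage_risk :: "('w, 'z, 'a) decision_model \<Rightarrow> 'w risk_measure \<Rightarrow>
    (real \<Rightarrow> ereal) \<Rightarrow> real \<Rightarrow> 'a \<Rightarrow> ereal" where
  "stage_risk m \<rho> v x a =
     \<rho> (\<lambda>w. let x' = trans m x a (rep m w)
            in cost m x a x' + discount m * real_of_ereal (v x'))"

definition rule_op :: "('w, 'z, 'a) decision_model \<Rightarrow> 'w risk_measure \<Rightarrow>
    (real \<Rightarrow> 'a) \<Rightarrow> (real \<Rightarrow> ereal) \<Rightarrow> real \<Rightarrow> ereal" where
  "rule_op m \<rho> d v x = stage_risk m \<rho> v x (d x)"

definition bellman_op :: "('w, 'z, 'a) decision_model \<Rightarrow> 'w risk_measure \<Rightarrow>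
    (real \<Rightarrow> ereal) \<Rightarrow> real \<Rightarrow> ereal" where
  "bellman_op m \<rho> v x = (INF a\<in>adm_at m x. stage_risk m \<rho> v x a)"

text \<open>\<open>value_to_go m \<rho> \<pi> k n\<close>: value at time \<open>n\<close> with \<open>k\<close> stages remaining.\<close>

primrec value_to_go :: "('w, 'z, 'a) decision_model \<Rightarrow> 'w risk_measure \<Rightarrow>
    (nat \<Rightarrow> 'a history \<Rightarrow> 'a) \<Rightarrow> nat \<Rightarrow> nat \<Rightarrow> 'a history \<Rightarrow> ereal" where
  "value_to_go m \<rho> \<pi> 0 = (\<lambda>n h. 0)"
| "value_to_go m \<rho> \<pi> (Suc k) = (\<lambda>n h. let a = \<pi> n h in
     stage_risk m \<rho> (\<lambda>x'. value_to_go m \<rho> \<pi> k (Suc n) (extend_hist n h a x')) (snd h) a)"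

definition policy_value :: "('w, 'z, 'a) decision_model \<Rightarrow> 'w risk_measure \<Rightarrow>
    nat \<Rightarrow> nat \<Rightarrow> (nat \<Rightarrow> 'a history \<Rightarrow> 'a) \<Rightarrow> 'a history \<Rightarrow> ereal" where
  "policy_value m \<rho> N n \<pi> h = value_to_go m \<rho> \<pi> (N - n) n h"

definition opt_value :: "('w, 'z, 'a::polish_space) decision_model \<Rightarrow> 'w risk_measure \<Rightarrow>
    nat \<Rightarrow> nat \<Rightarrow> 'a history \<Rightarrow> ereal" where
  "opt_value m \<rho> N n h = (INF \<pi>\<in>policies m (enat N). policy_value m \<rho> N n \<pi> h)"

lemma policy_value_markov:
  assumes "snd h = snd h'"
  shows "policy_value m \<rho> N n (as_policy d) h = policy_value m \<rho> N n (as_policy d) h'"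
proof -
  have "value_to_go m \<rho> (as_policy d) k n h = value_to_go m \<rho> (as_policy d) k n h'"
    if "snd h = snd h'" for k n and h h' :: "'a history"
    using that
  proof (induction k arbitrary: n h h')
    case 0
    then show ?case by simp
  next
    case (Suc k)
    have "value_to_go m \<rho> (as_policy d) k (Suc n) (extend_hist n h a x') =
          value_to_go m \<rho> (as_policy d) k (Suc n) (extend_hist n h' a x')" for a x'
      by (rule Suc.IH) (simp add: extend_hist_def)
    moreover have "as_policy d n h = as_policy d n h'"
      using Suc.prems by (simp add: as_policy_def)
    ultimately show ?case
      unfolding value_to_go.simps Let_def by (simp only: Suc.prems)
  qed
  from this [OF assms] show ?thesis unfolding policy_value_def .
qed

text \<open>The value of a Markov policy depends only on the current state by
  \<open>policy_value_markov\<close>, so it may be evaluated at any history ending in \<open>x\<close>.\<close>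

definition markov_value :: "('w, 'z, 'a::polish_space) decision_model \<Rightarrow> 'w risk_measure \<Rightarrow>
    nat \<Rightarrow> nat \<Rightarrow> real \<Rightarrow> ereal" where
  "markov_value m \<rho> N n x =
     Inf {policy_value m \<rho> N n (as_policy d) h | d h.
            d \<in> markov_policies m (enat N) \<and> h \<in> space (hist_space m n) \<and> snd h = x}"

text \<open>\<open>J_pol m \<rho> d N\<close> is \<open>rule_op (d 0) (\<dots> (rule_op (d (N - 1)) 0))\<close>.\<close>

definition J_pol :: "('w, 'z, 'a) decision_model \<Rightarrow> 'w risk_measure \<Rightarrow>
    (nat \<Rightarrow> real \<Rightarrow> 'a) \<Rightarrow> nat \<Rightarrow> real \<Rightarrow> ereal" where
  "J_pol m \<rho> d N = foldr (\<lambda>n. rule_op m \<rho> (d n)) [0..<N] (\<lambda>_. 0)"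

definition J_fin :: "('w, 'z, 'a::polish_space) decision_model \<Rightarrow> 'w risk_measure \<Rightarrow>
    nat \<Rightarrow> real \<Rightarrow> ereal" where
  "J_fin m \<rho> N x = (INF d\<in>markov_policies m \<infinity>. J_pol m \<rho> d N x)"

definition J_inf_pol :: "('w, 'z, 'a) decision_model \<Rightarrow> 'w risk_measure \<Rightarrow>
    (nat \<Rightarrow> real \<Rightarrow> 'a) \<Rightarrow> real \<Rightarrow> ereal" where
  "J_inf_pol m \<rho> d x = lim (\<lambda>N. J_pol m \<rho> d N x)"

definition J_inf :: "('w, 'z, 'a::polish_space) decision_model \<Rightarrow> 'w risk_measure \<Rightarrow>
    real \<Rightarrow> ereal" where
  "J_inf m \<rho> x = (INF d\<in>markov_policies m \<infinity>. J_inf_pol m \<rho> d x)"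

definition J_lim :: "('w, 'z, 'a::polish_space) decision_model \<Rightarrow> 'w risk_measure \<Rightarrow>
    real \<Rightarrow> ereal" where
  "J_lim m \<rho> x = lim (\<lambda>N. J_fin m \<rho> N x)"

section \<open>Bounding functions\<close>

definition bounding_pair :: "(real \<Rightarrow> real) \<Rightarrow> (real \<Rightarrow> real) \<Rightarrow> bool" where
  "bounding_pair bl bu \<longleftrightarrow>
     bl \<in> borel_measurable borel \<and> bu \<in> borel_measurable borel \<and>
     (\<exists>el\<ge>0. \<exists>eu\<ge>0. el + eu = 1 \<and> (\<forall>x. bl x \<le> - el \<and> eu \<le> bu x))"

definition locally_dominated ::
    "('w, 'z, 'a::polish_space) decision_model \<Rightarrow> real \<Rightarrow> (real \<Rightarrow> real) \<Rightarrow> bool" where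
  "locally_dominated m p b \<longleftrightarrow>
     (\<forall>xa\<in>adm m. \<exists>e>0. \<exists>\<Theta>1\<in>borel_measurable (noise m). \<exists>\<Theta>2\<in>borel_measurable (noise m).
        (\<forall>z\<in>space (noise m). 0 \<le> \<Theta>1 z \<and> 0 \<le> \<Theta>2 z) \<and>
        (\<lambda>w. \<Theta>1 (rep m w)) \<in> Lp (prob m) p \<and>
        (\<lambda>w. \<Theta>2 (rep m w)) \<in> Lp (prob m) p \<and>
        (\<forall>z\<in>space (noise m). \<forall>(x, a)\<in>adm m \<inter> cball xa e.
           \<bar>cost m x a (trans m x a z)\<bar> \<le> \<Theta>1 z \<and> b (trans m x a z) \<le> \<Theta>2 z))"

text \<open>The real bounds force the members of this set to be real-valued.\<close>

definition lsc_incr_between :: "(real \<Rightarrow> real) \<Rightarrow> (real \<Rightarrow> real) \<Rightarrow> (real \<Rightarrow> ereal) set" where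
  "lsc_incr_between bl bu =
     {v. lsc_on UNIV v \<and> mono v \<and> (\<forall>x. ereal (bl x) \<le> v x \<and> v x \<le> ereal (bu x))}"

end

theory Submission
  imports Defs
begin

text \<open>Finite horizon: for increasing lower semicontinuous \<open>v\<close> the map
  \<open>(x, a) \<mapsto> \<rho> (c + \<beta> v (T))\<close> is lower semicontinuous, because monotonicity lets one replace the
  transitions \<open>T (x\<^sub>k, a\<^sub>k, z)\<close> by their minima with \<open>T (x, a, z)\<close>, which converge, and local
  domination makes the Fatou property applicable. Hence a measurable minimizer exists and the
  Bellman operator preserves such \<open>v\<close>; backward induction does the rest.

  Infinite horizon: by coherence all operators are contractions with modulus \<open>\<alpha> \<beta>\<close> for the weight
  \<open>bu - bl\<close>. This weight need not be locally bounded, so contraction alone does not carry lower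
  semicontinuity to the limit. The increasing majorant \<open>sup {bl y | y \<le> x}\<close> of the lower bound
  inherits all its estimates and is locally bounded below, which gives the one-sided locally uniform
  estimate that is needed.\<close>

text \<open>For a merely monetary risk measure the Bellman operator need not respect the bounds. In
  the finite-horizon case they are therefore read off from policy values: the iterate at time n is
  recognised as the value of a Markov policy already built, which forces minimizers and regularity
  into one induction. Under coherence the operator itself yields the bounds, and this is the origin
  of the factor 1 / (1 - \<alpha>\<beta>): with the enlarged bu, a cost of risk at most (1 -
  \<alpha>\<beta>) bu and a discounted continuation of risk at most \<alpha>\<beta> bu add up to bu
  again. Subadditivity estimates the risk of a sum only from above, so every comparison has the form
  v \<le> w + K g, and two-sided estimates come from exchanging v and w; this form also avoids
  differences of extended reals. The increasing majorant inherits the estimates of the lower bound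
  because the action sets decrease: an action admissible at x is admissible at every y \<le> x,
  where it leads to smaller states and smaller costs.\<close>

section \<open>Measurable selection of minimizers\<close>

lemma lsc_on_pairD:
  assumes "lsc_on {(x, a). a \<in> G x} (\<lambda>(x, a). g x a)" "a \<in> G x"
    and "\<And>k. b k \<in> G (u k)" "(\<lambda>k. (u k, b k)) \<longlonglongrightarrow> (x, a)"
  shows "g x a \<le> liminf (\<lambda>k. g (u k) (b k))"
proof -
  have "(\<lambda>(x, a). g x a) (x, a) \<le> liminf (\<lambda>k. (\<lambda>(x, a). g x a) (u k, b k))"
    by (rule assms(1)[unfolded lsc_on_def, rule_format]) (use assms(2-4) in auto)
  then show ?thesis by simp
qed

lemma lsc_on_borel_measurable:
  fixes f :: "'b::metric_space \<Rightarrow> ereal"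
  assumes "lsc_on UNIV f"
  shows "f \<in> borel_measurable borel"
proof (rule borel_measurableI_greater)
  fix y
  have "closed {x. f x \<le> y}"
    unfolding closed_sequential_limits
  proof (intro allI impI, elim conjE)
    fix u l assume u: "\<forall>n. u n \<in> {x. f x \<le> y}" "u \<longlonglongrightarrow> l"
    have "f l \<le> liminf (\<lambda>k. f (u k))" using assms u(2) by (auto simp: lsc_on_def)
    also have "\<dots> \<le> liminf (\<lambda>k. y)" by (rule Liminf_mono) (use u in auto)
    finally show "l \<in> {x. f x \<le> y}" by (simp add: Liminf_const)
  qed
  then have "open (- {x. f x \<le> y})" by auto
  moreover have "- {x. f x \<le> y} = {x. y < f x}" by auto
  ultimately show "{x \<in> space borel. y < f x} \<in> sets borel" by simp
qed

lemma usc_correspondenceE: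
  assumes "usc_correspondence G" "u \<longlonglongrightarrow> x" "\<And>k. a k \<in> G (u k)"
  obtains l r where "l \<in> G x" "strict_mono r" "(a \<circ> r) \<longlonglongrightarrow> l"
  using assms unfolding usc_correspondence_def by blast

lemma usc_correspondence_hit_closed:
  assumes "usc_correspondence G" "closed C"
  shows "closed {x. G x \<inter> C \<noteq> {}}"
  unfolding closed_sequential_limits
proof (intro allI impI, elim conjE)
  fix u x assume u: "\<forall>n. u n \<in> {x. G x \<inter> C \<noteq> {}}" "u \<longlonglongrightarrow> x"
  then have "\<forall>n. \<exists>a. a \<in> G (u n) \<inter> C" by blast
  then obtain a where a: "\<And>n. a n \<in> G (u n) \<inter> C" by metis
  then obtain l r where l: "l \<in> G x" "strict_mono r" "(a \<circ> r) \<longlonglongrightarrow> l"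
    using usc_correspondenceE[OF assms(1) u(2), of a] by blast
  have "l \<in> C" using closed_sequentially[OF assms(2) _ l(3)] a by auto
  with l show "x \<in> {x. G x \<inter> C \<noteq> {}}" by blast
qed

text \<open>Berge's argument along a subsequence: points with values below a level c accumulate in
  \<open>G x\<close>, and in \<open>C\<close> because \<open>C\<close> is closed. The set
  \<open>C\<close> is carried along because the selection step tests the sets of minimizers against
  every closed set. An empty \<open>G x \<inter> C\<close> counts as the value \<infinity> and is
  covered by the same contradiction.\<close>

lemma lsc_on_INF_usc_correspondence:
  fixes g :: "'b::metric_space \<Rightarrow> 'a::metric_space \<Rightarrow> ereal"
  assumes G: "usc_correspondence G" and C: "closed C"
    and g: "lsc_on {(x, a). a \<in> G x} (\<lambda>(x, a). g x a)"
  shows "lsc_on UNIV (\<lambda>x. INF a\<in>G x \<inter> C. g x a)"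
  unfolding lsc_on_def
proof (intro ballI allI impI)
  fix x :: 'b and u assume u: "u \<longlonglongrightarrow> x"
  let ?H = "\<lambda>x. INF a\<in>G x \<inter> C. g x a"
  show "?H x \<le> liminf (\<lambda>k. ?H (u k))"
  proof (rule ccontr)
    assume "\<not> ?thesis"
    then have "liminf (\<lambda>k. ?H (u k)) < ?H x" by (simp only: not_le)
    from dense[OF this] obtain c where c: "liminf (\<lambda>k. ?H (u k)) < c" "c < ?H x" by blast
    have "\<not> (\<forall>\<^sub>F k in sequentially. c \<le> ?H (u k))"
      using Liminf_bounded[of c "\<lambda>k. ?H (u k)" sequentially] c(1) by auto
    then have "infinite {k. ?H (u k) < c}"
      by (simp add: not_eventually not_le frequently_cofinite flip: cofinite_eq_sequentially)
    then obtain r :: "nat \<Rightarrow> nat" where r: "strict_mono r" "\<And>k. ?H (u (r k)) < c"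
      using infinite_enumerate by blast
    then have "\<exists>a. a \<in> G (u (r k)) \<inter> C \<and> g (u (r k)) a < c" for k
      using r(2)[of k] unfolding INF_less_iff by blast
    then obtain a where a: "\<And>k. a k \<in> G (u (r k)) \<inter> C" "\<And>k. g (u (r k)) (a k) < c"
      using choice[of "\<lambda>k a. a \<in> G (u (r k)) \<inter> C \<and> g (u (r k)) a < c"] by blast
    have ur: "(u \<circ> r) \<longlonglongrightarrow> x" using u r(1) by (rule LIMSEQ_subseq_LIMSEQ)
    then obtain l s where l: "l \<in> G x" "strict_mono s" "(a \<circ> s) \<longlonglongrightarrow> l"
      using usc_correspondenceE[OF G ur, of a] a(1) by auto
    have lC: "l \<in> C" using closed_sequentially[OF C _ l(3)] a by auto
    have "(\<lambda>k. (u (r (s k)), a (s k))) \<longlonglongrightarrow> (x, l)"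
      using tendsto_Pair[OF LIMSEQ_subseq_LIMSEQ[OF ur l(2)] l(3)] by (simp add: o_def)
    then have "g x l \<le> liminf (\<lambda>k. g (u (r (s k))) (a (s k)))"
      using a(1) by (intro lsc_on_pairD[OF g l(1)]) auto
    also have "\<dots> \<le> liminf (\<lambda>k. c)" by (rule Liminf_mono) (simp add: a(2) less_imp_le)
    finally have "g x l \<le> c" by (simp add: Liminf_const)
    moreover have "?H x \<le> g x l" using l(1) lC by (intro INF_lower) auto
    ultimately show False using c(2) by simp
  qed
qed

lemma INF_usc_correspondence_attained:
  fixes g :: "'b::metric_space \<Rightarrow> 'a::metric_space \<Rightarrow> ereal"
  assumes G: "usc_correspondence G" and C: "closed C" and ne: "G x \<inter> C \<noteq> {}"
    and g: "lsc_on {(x, a). a \<in> G x} (\<lambda>(x, a). g x a)"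
  shows "\<exists>a\<in>G x \<inter> C. g x a = (INF a\<in>G x \<inter> C. g x a)"
proof -
  obtain w where w: "\<And>n. w n \<in> g x ` (G x \<inter> C)" "w \<longlonglongrightarrow> (INF a\<in>G x \<inter> C. g x a)"
    using Inf_as_limit[of "g x ` (G x \<inter> C)"] ne by blast
  then have "\<forall>n. \<exists>a. a \<in> G x \<inter> C \<and> w n = g x a" by blast
  then obtain a where a: "\<And>n. a n \<in> G x \<inter> C" "\<And>n. w n = g x (a n)" by metis
  \<comment> \<open>Along the constant sequence x, upper semicontinuity amounts to sequential
    compactness of \<open>G x\<close>.\<close>
  obtain l r where l: "l \<in> G x" "strict_mono r" "(a \<circ> r) \<longlonglongrightarrow> l"
    using usc_correspondenceE[OF G tendsto_const, of a x] a(1) by blast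
  have lC: "l \<in> C" using closed_sequentially[OF C _ l(3)] a by auto
  have "(\<lambda>k. (x, a (r k))) \<longlonglongrightarrow> (x, l)"
    using tendsto_Pair[OF tendsto_const l(3)] by (simp add: o_def)
  then have "g x l \<le> liminf (\<lambda>k. g x (a (r k)))"
    using a(1) by (intro lsc_on_pairD[OF g l(1)]) auto
  also have "\<dots> = (INF a\<in>G x \<inter> C. g x a)"
    using lim_imp_Liminf[OF _ LIMSEQ_subseq_LIMSEQ[OF w(2) l(2)]] a(2) by (simp add: o_def)
  finally show ?thesis using l(1) lC by (intro bexI[of _ l] antisym INF_lower) auto
qed

text \<open>A selection theorem of Kuratowski-Ryll-Nardzewski type, with the measurability
  hypothesis on closed sets. Indices into a dense sequence are chosen greedily: at each stage the
  least one whose closed ball still meets \<open>F x\<close> inside all earlier balls. Only closed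
  sets are tested, so each choice is measurable, and the radii 1 / 2 ^ n force the centres to
  converge to a point of \<open>F x\<close>.\<close>

lemma measurable_selection_closed:
  fixes F :: "'b \<Rightarrow> 'a::polish_space set"
  assumes cl: "\<And>x. x \<in> space M \<Longrightarrow> closed (F x)"
    and ne: "\<And>x. x \<in> space M \<Longrightarrow> F x \<noteq> {}"
    and meas: "\<And>C. closed C \<Longrightarrow> {x \<in> space M. F x \<inter> C \<noteq> {}} \<in> sets M"
  shows "\<exists>f \<in> borel_measurable M. \<forall>x\<in>space M. f x \<in> F x"
proof -
  obtain D :: "'a set" where D: "countable D" "\<And>U. open U \<Longrightarrow> U \<noteq> {} \<Longrightarrow> \<exists>d\<in>D. d \<in> U"
    using countable_dense_exists by auto
  have "D \<noteq> {}" using D(2)[of UNIV] by auto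
  define s where "s = from_nat_into D"
  have dense: "\<exists>j. dist (s j) y \<le> e" if "0 < e" for y e
  proof -
    have "y \<in> ball y e" using that by simp
    then obtain d where "d \<in> D" "d \<in> ball y e" using D(2)[of "ball y e"] by blast
    then obtain j where "s j = d" using from_nat_into_surj[OF D(1)] unfolding s_def by blast
    then show ?thesis using \<open>d \<in> ball y e\<close> by (intro exI[of _ j]) (auto simp: dist_commute)
  qed
  \<comment> \<open>The choices made so far are recorded as a list of indices, because there are
    only countably many such lists; the measurability argument below rests on this.\<close>
  define B where "B l = (\<Inter>i<length l. cball (s (l ! i)) (1 / 2 ^ i))" for l :: "nat list"
  define nxt where "nxt x l = (LEAST j. F x \<inter> B (l @ [j]) \<noteq> {})" for x l
  define q where "q x = rec_nat [] (\<lambda>_ l. l @ [nxt x l])" for x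
  have q0: "q x 0 = []" and qS: "q x (Suc n) = q x n @ [nxt x (q x n)]" for x n
    by (simp_all add: q_def)
  have len: "length (q x n) = n" for x n by (induction n) (simp_all add: q0 qS)
  have B_snoc: "B (l @ [j]) = B l \<inter> cball (s j) (1 / 2 ^ length l)" for l j
    by (simp add: B_def lessThan_Suc nth_append Int_commute)
  have closedB: "closed (B l)" for l unfolding B_def by auto
  define f where "f n x = s (nxt x (q x n))" for n x
  have step: "F x \<inter> B (l @ [nxt x l]) \<noteq> {}" if "F x \<inter> B l \<noteq> {}" for x l
  proof -
    from that obtain y where y: "y \<in> F x" "y \<in> B l" by auto
    obtain j where "dist (s j) y \<le> 1 / 2 ^ length l" using dense[of "1 / 2 ^ length l"] by auto
    then have "F x \<inter> B (l @ [j]) \<noteq> {}" using y by (auto simp: B_snoc)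
    then show ?thesis unfolding nxt_def by (rule LeastI)
  qed
  have q_ne: "F x \<inter> B (q x n) \<noteq> {}" if "x \<in> space M" for x n
  proof (induction n)
    case 0 show ?case using ne[OF that] by (simp add: q0 B_def)
  next
    case (Suc n) then show ?case unfolding qS by (rule step)
  qed
  have B_q: "B (q x m) \<subseteq> cball (f n x) (1 / 2 ^ n)" if "n < m" for n m x
    using that
  proof (induction m)
    case (Suc m)
    then show ?case by (cases "n = m") (auto simp: qS B_snoc len f_def less_Suc_eq)
  qed simp
  have lim: "\<exists>l\<in>F x. (\<lambda>n. f n x) \<longlonglongrightarrow> l" if x: "x \<in> space M" for x
  proof -
    \<comment> \<open>The centres \<open>f n x\<close> need not lie in \<open>F x\<close>, but these
      witnesses do, and they have the same limit. The ball around \<open>f n x\<close> is imposed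
      only from the list \<open>q x (Suc n)\<close> on.\<close>
    have "\<forall>n. \<exists>y. y \<in> F x \<inter> B (q x (Suc n))" using q_ne[OF x] by blast
    then obtain y where y: "\<And>n. y n \<in> F x \<inter> B (q x (Suc n))" by metis
    have yf: "dist (f n x) (y k) \<le> 1 / 2 ^ n" if "n \<le> k" for n k
      using y[of k] B_q[of n "Suc k" x] that by auto
    have p0: "(\<lambda>n. 1 / 2 ^ n :: real) \<longlonglongrightarrow> 0"
      using LIMSEQ_realpow_zero[of "1/2::real"] by (simp add: power_one_over)
    have "Cauchy y"
    proof (rule metric_CauchyI)
      fix e :: real assume "0 < e"
      then obtain N where N: "1 / 2 ^ N < e / 2"
        using order_tendstoD(2)[OF p0, of "e/2"] by (auto simp: eventually_sequentially)
      have "dist (y i) (y j) < e" if "N \<le> i" "N \<le> j" for i j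
        using yf[OF that(1)] yf[OF that(2)] N dist_triangle3[of "y i" "y j" "f N x"] by linarith
      then show "\<exists>N. \<forall>i\<ge>N. \<forall>j\<ge>N. dist (y i) (y j) < e" by blast
    qed
    then obtain l where l: "y \<longlonglongrightarrow> l" using Cauchy_convergent convergent_def by blast
    have "(\<lambda>n. dist (f n x) l) \<longlonglongrightarrow> 0"
    proof (rule tendsto_sandwich[OF _ _ tendsto_const])
      show "(\<lambda>n. 1 / 2 ^ n + dist (y n) l) \<longlonglongrightarrow> 0"
        using tendsto_add[OF p0 tendsto_dist[OF l tendsto_const[of l]]] by simp
      have "dist (f n x) l \<le> 1 / 2 ^ n + dist (y n) l" for n
        using yf[of n n] dist_triangle[of "f n x" l "y n"] by simp
      then show "\<forall>\<^sub>F n in sequentially. dist (f n x) l \<le> 1 / 2 ^ n + dist (y n) l" by simp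
    qed simp
    then have "(\<lambda>n. f n x) \<longlonglongrightarrow> l" by (rule tendsto_dist_iff[THEN iffD2])
    moreover have "l \<in> F x" using closed_sequentially[OF cl[OF x] _ l] y by auto
    ultimately show ?thesis by blast
  qed
  have nxt_meas: "(\<lambda>x. nxt x l) \<in> M \<rightarrow>\<^sub>M count_space UNIV" for l
    unfolding nxt_def using meas[OF closedB] by (intro measurable_Least) (auto simp: pred_def)
  have q_meas: "(\<lambda>x. q x n) \<in> M \<rightarrow>\<^sub>M count_space UNIV" for n
  proof (induction n)
    case (Suc n)
    \<comment> \<open>A countable family of measurable maps, evaluated at a measurably chosen index,
      is measurable.\<close>
    have "(\<lambda>x. (\<lambda>l x. l @ [nxt x l]) (q x n) x) \<in> M \<rightarrow>\<^sub>M count_space UNIV"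
      by (rule measurable_compose_countable[OF measurable_compose[OF nxt_meas] Suc]) simp
    then show ?case by (simp add: qS)
  qed (simp add: q0)
  have f_meas: "f n \<in> borel_measurable M" for n
  proof -
    have "(\<lambda>x. (\<lambda>l x. nxt x l) (q x n) x) \<in> M \<rightarrow>\<^sub>M count_space UNIV"
      by (rule measurable_compose_countable[OF nxt_meas q_meas])
    then show ?thesis unfolding f_def by (rule measurable_compose) simp
  qed
  have "\<forall>x. \<exists>l. x \<in> space M \<longrightarrow> l \<in> F x \<and> (\<lambda>n. f n x) \<longlonglongrightarrow> l" using lim by blast
  then obtain g where g: "\<And>x. x \<in> space M \<Longrightarrow> g x \<in> F x \<and> (\<lambda>n. f n x) \<longlonglongrightarrow> g x" by metis
  then have "g \<in> borel_measurable M" using f_meas borel_measurable_LIMSEQ_metric[of f M g] by blast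
  with g show ?thesis by blast
qed

text \<open>The selection theorem is applied to the sets of minimizers. Whether such a set meets a
  closed \<open>C\<close> is decided by comparing the infimum over \<open>G x \<inter> C\<close>
  with the full infimum, and both are lower semicontinuous in x, hence Borel.\<close>

lemma lsc_measurable_minimizer:
  fixes G :: "'b::metric_space \<Rightarrow> 'a::polish_space set"
  assumes G: "usc_correspondence G" and ne: "\<And>x. G x \<noteq> {}"
    and g: "lsc_on {(x, a). a \<in> G x} (\<lambda>(x, a). g x a)"
  shows "\<exists>d\<in>borel_measurable borel. \<forall>x. d x \<in> G x \<and> g x (d x) = (INF a\<in>G x. g x a)"
proof -
  let ?V = "\<lambda>x. INF a\<in>G x. g x a"
  let ?F = "\<lambda>x. {a \<in> G x. g x a \<le> ?V x}"
  have lscC: "(\<lambda>x. INF a\<in>G x \<inter> C. g x a) \<in> borel_measurable borel" if "closed C" for C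
    by (rule lsc_on_borel_measurable[OF lsc_on_INF_usc_correspondence[OF G that g]])
  have V: "?V \<in> borel_measurable borel" using lscC[of UNIV] by simp
  have "\<exists>d\<in>borel_measurable borel. \<forall>x\<in>space borel. d x \<in> ?F x"
  proof (rule measurable_selection_closed)
    show "closed (?F x)" for x
      unfolding closed_sequential_limits
    proof (intro allI impI, elim conjE)
      fix a l assume a: "\<forall>n. a n \<in> ?F x" "a \<longlonglongrightarrow> l"
      obtain l' r where l': "l' \<in> G x" "strict_mono r" "(a \<circ> r) \<longlonglongrightarrow> l'"
        using usc_correspondenceE[OF G tendsto_const, of a x] a(1) by blast
      \<comment> \<open>Upper semicontinuity provides a limit in \<open>G x\<close> along a
        subsequence; since the sequence already converges to \<open>l\<close>, this shows that
        \<open>G x\<close> is closed.\<close>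
      have "l' = l" using LIMSEQ_unique[OF l'(3)] LIMSEQ_subseq_LIMSEQ[OF a(2) l'(2)] by blast
      have "(\<lambda>k. (x, a k)) \<longlonglongrightarrow> (x, l)" using tendsto_Pair[OF tendsto_const a(2)] .
      then have "g x l \<le> liminf (\<lambda>k. g x (a k))"
        using a(1) l'(1) \<open>l' = l\<close> by (intro lsc_on_pairD[OF g]) auto
      also have "\<dots> \<le> liminf (\<lambda>k. ?V x)" by (rule Liminf_mono) (use a(1) in auto)
      finally show "l \<in> ?F x" using l'(1) \<open>l' = l\<close> by (simp add: Liminf_const)
    qed
    show "?F x \<noteq> {}" for x
      using INF_usc_correspondence_attained[OF G closed_UNIV _ g, of x] ne[of x] by fastforce
    fix C :: "'a set" assume C: "closed C"
    let ?H = "\<lambda>x. INF a\<in>G x \<inter> C. g x a"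
    \<comment> \<open>The direction from right to left needs the infimum over
      \<open>G x \<inter> C\<close> to be attained. Nonemptiness is a separate condition: the
      infimum over the empty set is \<infinity>, which would pass the comparison when
      \<open>?V x\<close> is \<infinity> too.\<close>
    have "?F x \<inter> C \<noteq> {} \<longleftrightarrow> G x \<inter> C \<noteq> {} \<and> ?H x \<le> ?V x" for x
    proof
      assume "?F x \<inter> C \<noteq> {}"
      then obtain a where "a \<in> G x \<inter> C" "g x a \<le> ?V x" by auto
      then show "G x \<inter> C \<noteq> {} \<and> ?H x \<le> ?V x"
        using INF_lower[of a "G x \<inter> C" "g x"] by (auto intro: order_trans)
    next
      assume "G x \<inter> C \<noteq> {} \<and> ?H x \<le> ?V x"
      then show "?F x \<inter> C \<noteq> {}"
        using INF_usc_correspondence_attained[OF G C _ g, of x] by fastforce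
    qed
    then have "{x \<in> space borel. ?F x \<inter> C \<noteq> {}} =
        {x. G x \<inter> C \<noteq> {}} \<inter> {x \<in> space borel. ?H x \<le> ?V x}" by auto
    also have "\<dots> \<in> sets borel"
      using borel_measurable_le[OF lscC[OF C] V] usc_correspondence_hit_closed[OF G C] by auto
    finally show "{x \<in> space borel. ?F x \<inter> C \<noteq> {}} \<in> sets borel" .
  qed
  then obtain d where "d \<in> borel_measurable borel" "\<And>x. d x \<in> ?F x" by auto
  then show ?thesis by (intro bexI[of _ d]) (auto intro!: antisym INF_lower)
qed

section \<open>Lower semicontinuity of the one-stage risk\<close>

lemma Lp_dominated:
  assumes "0 \<le> p" "Y \<in> Lp M p" "X \<in> borel_measurable M"
    and "\<And>w. w \<in> space M \<Longrightarrow> \<bar>X w\<bar> \<le> Y w"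
  shows "X \<in> Lp M p"
proof -
  have "integrable M (\<lambda>w. \<bar>X w\<bar> powr p)"
  proof (rule Bochner_Integration.integrable_bound)
    show "integrable M (\<lambda>w. \<bar>Y w\<bar> powr p)" using assms(2) by (simp add: Lp_def)
    show "(\<lambda>w. \<bar>X w\<bar> powr p) \<in> borel_measurable M" using assms(3) by measurable
    show "AE w in M. norm (\<bar>X w\<bar> powr p) \<le> norm (\<bar>Y w\<bar> powr p)"
    proof (rule AE_I2)
      fix w assume "w \<in> space M"
      then have "\<bar>X w\<bar> \<le> \<bar>Y w\<bar>" using assms(4) abs_ge_self[of "Y w"] by (meson order_trans)
      then show "norm (\<bar>X w\<bar> powr p) \<le> norm (\<bar>Y w\<bar> powr p)"
        using assms(1) by (simp add: powr_mono2)
    qed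
  qed
  then show ?thesis using assms(3) by (simp add: Lp_def)
qed

lemma Lp_scale:
  assumes "X \<in> Lp M p"
  shows "(\<lambda>w. c * X w) \<in> Lp M p"
proof -
  have "integrable M (\<lambda>w. \<bar>c\<bar> powr p * \<bar>X w\<bar> powr p)"
    using assms by (auto simp: Lp_def)
  then show ?thesis using assms by (auto simp: Lp_def abs_mult powr_mult)
qed

lemma Lp_add:
  assumes p: "0 \<le> p" and X: "X \<in> Lp M p" and Y: "Y \<in> Lp M p"
  shows "(\<lambda>w. X w + Y w) \<in> Lp M p"
proof -
  have [measurable]: "X \<in> borel_measurable M" "Y \<in> borel_measurable M"
    using X Y by (auto simp: Lp_def)
  have "\<bar>X w + Y w\<bar> powr p \<le> 2 powr p * (\<bar>X w\<bar> powr p + \<bar>Y w\<bar> powr p)" for w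
  proof -
    \<comment> \<open>Bounding the sum by twice the maximum gives the power estimate without an
      appeal to convexity.\<close>
    have "\<bar>X w + Y w\<bar> powr p \<le> (2 * max \<bar>X w\<bar> \<bar>Y w\<bar>) powr p"
      using p by (intro powr_mono2) auto
    also have "\<dots> = 2 powr p * max \<bar>X w\<bar> \<bar>Y w\<bar> powr p" by (simp add: powr_mult)
    also have "max \<bar>X w\<bar> \<bar>Y w\<bar> powr p \<le> \<bar>X w\<bar> powr p + \<bar>Y w\<bar> powr p"
      by (auto simp: max_def)
    finally show ?thesis by simp
  qed
  moreover have "integrable M (\<lambda>w. 2 powr p * (\<bar>X w\<bar> powr p + \<bar>Y w\<bar> powr p))"
    using X Y by (simp add: Lp_def)
  ultimately have "integrable M (\<lambda>w. \<bar>X w + Y w\<bar> powr p)"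
    by (elim Bochner_Integration.integrable_bound) (simp_all add: add_nonneg_nonneg)
  then show ?thesis by (simp add: Lp_def)
qed

text \<open>The Fatou property asks for convergence, while lower semicontinuity only provides
  asymptotic lower bounds. The variables \<open>Z k\<close>, the tail infima capped by
  \<open>X0\<close>, lie below \<open>X k\<close>, keep the dominating variable \<open>Y\<close>,
  and do converge to \<open>X0\<close>; monotonicity then carries the estimate back to
  \<open>X k\<close>.\<close>

lemma Fatou_property_liminf:
  assumes p: "0 \<le> p" and mon: "monetary M p \<rho>" and Fat: "Fatou_property M p \<rho>"
    and Y: "Y \<in> Lp M p" and X0: "X0 \<in> Lp M p" and X: "\<And>k. X k \<in> borel_measurable M"
    and bd: "\<And>k w. w \<in> space M \<Longrightarrow> \<bar>X k w\<bar> \<le> Y w"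
    and bd0: "\<And>w. w \<in> space M \<Longrightarrow> \<bar>X0 w\<bar> \<le> Y w"
    and lim: "\<And>w e. w \<in> space M \<Longrightarrow> 0 < e \<Longrightarrow> \<forall>\<^sub>F k in sequentially. X0 w - e < X k w"
  shows "\<rho> X0 \<le> liminf (\<lambda>k. \<rho> (X k))"
proof -
  define Z where "Z k w = min (X0 w) (INF j. X (k + j) w)" for k w
  have bdd: "bdd_below (range (\<lambda>j. X (k + j) w))" if "w \<in> space M" for k w
    using bd[OF that] by (intro bdd_belowI[of _ "- Y w"]) (auto simp: abs_le_iff minus_le_iff)
  have [measurable]: "X0 \<in> borel_measurable M" "\<And>k. X k \<in> borel_measurable M"
    using X0 X by (auto simp: Lp_def)
  have [measurable]: "Z k \<in> borel_measurable M" for k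
    unfolding Z_def using bdd by measurable
  have ZX: "Z k w \<le> X k w" if "w \<in> space M" for k w
    unfolding Z_def using cINF_lower[OF bdd[OF that], of 0 k] by (auto simp: min_le_iff_disj)
  have Zbd: "\<bar>Z k w\<bar> \<le> Y w" if "w \<in> space M" for k w
  proof -
    have "- Y w \<le> (INF j. X (k + j) w)"
      using bd[OF that] by (intro cINF_greatest) (auto simp: abs_le_iff minus_le_iff)
    then show ?thesis using bd0[OF that] unfolding Z_def by (auto simp: min_def)
  qed
  have Zlim: "(\<lambda>k. Z k w) \<longlonglongrightarrow> X0 w" if w: "w \<in> space M" for w
  proof (rule LIMSEQ_I)
    fix e :: real assume "0 < e"
    then obtain N where N: "\<And>k. N \<le> k \<Longrightarrow> X0 w - e / 2 < X k w"
      using lim[OF w, of "e/2"] by (auto simp: eventually_sequentially)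
    have "norm (Z k w - X0 w) < e" if "N \<le> k" for k
    proof -
      have "X0 w - e / 2 \<le> (INF j. X (k + j) w)"
        using N that by (intro cINF_greatest) (auto intro: less_imp_le)
      then show ?thesis using \<open>0 < e\<close> unfolding Z_def by (auto simp: min_def)
    qed
    then show "\<exists>N. \<forall>k\<ge>N. norm (Z k w - X0 w) < e" by blast
  qed
  have ZLp: "Z k \<in> Lp M p" for k by (rule Lp_dominated[OF p Y _ Zbd]) auto
  have XLp: "X k \<in> Lp M p" for k by (rule Lp_dominated[OF p Y X bd])
  have "\<rho> X0 \<le> liminf (\<lambda>k. \<rho> (Z k))"
    using Fat[unfolded Fatou_property_def, rule_format, of Z Y X0] ZLp Y X0 Zbd Zlim by auto
  also have "\<dots> \<le> liminf (\<lambda>k. \<rho> (X k))"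
  proof (rule Liminf_mono, rule always_eventually, rule allI)
    fix k
    show "\<rho> (Z k) \<le> \<rho> (X k)"
      using mon[unfolded monetary_def, THEN conjunct1, rule_format, OF ZLp XLp AE_I2] ZX by blast
  qed
  finally show ?thesis .
qed

lemma lsc_on_real_eventually:
  assumes "lsc_on S (\<lambda>x. ereal (f x))" "x \<in> S" "\<And>k. u k \<in> S" "u \<longlonglongrightarrow> x" "0 < e"
  shows "\<forall>\<^sub>F k in sequentially. f x - e < f (u k)"
proof -
  have "ereal (f x) \<le> liminf (\<lambda>k. ereal (f (u k)))" using assms by (auto simp: lsc_on_def)
  then have "\<forall>\<^sub>F k in sequentially. ereal (f x - e) < ereal (f (u k))"
    unfolding le_Liminf_iff using assms(5) by (elim allE[of _ "ereal (f x - e)"]) simp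
  then show ?thesis by simp
qed

section \<open>Setting shared by both horizons\<close>

locale risk_mdp =
  fixes m :: "('w, 'z, 'a::polish_space) decision_model"
    and p :: real
    and \<rho> :: "'w risk_measure"
    and bl bu :: "real \<Rightarrow> real"
  assumes p: "1 \<le> p"
    and model: "stationary_model m"
    and M2_usc: "usc_correspondence (adm_at m)"
    and M2_decreasing: "\<And>x y. x \<le> y \<Longrightarrow> adm_at m y \<subseteq> adm_at m x"
    and M3_lsc: "\<And>z. z \<in> space (noise m) \<Longrightarrow> lsc_on (adm m) (\<lambda>(x, a). ereal (trans m x a z))"
    and M3_incr: "\<And>z x y a. z \<in> space (noise m) \<Longrightarrow> (x, a) \<in> adm m \<Longrightarrow> (y, a) \<in> adm m \<Longrightarrow>
            x \<le> y \<Longrightarrow> trans m x a z \<le> trans m y a z"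
    and M4_lsc: "lsc_on {(x, a, x'). (x, a) \<in> adm m} (\<lambda>(x, a, x'). ereal (cost m x a x'))"
    and M4_incr: "\<And>x y a x' y'. (x, a) \<in> adm m \<Longrightarrow> (y, a) \<in> adm m \<Longrightarrow>
            x \<le> y \<Longrightarrow> x' \<le> y' \<Longrightarrow> cost m x a x' \<le> cost m y a y'"
    and bounds: "bounding_pair bl bu"
    and dominated: "locally_dominated m p (\<lambda>x. bu x - bl x)"
    and monetary: "monetary (prob m) p \<rho>"
    and Fatou: "Fatou_property (prob m) p \<rho>"
begin

abbreviation "M \<equiv> prob m"
abbreviation "\<beta> \<equiv> discount m"
abbreviation "T x a w \<equiv> trans m x a (rep m w)"

text \<open>The continuation value of an arbitrary policy is only known to be measurable and
  bounded, so this class has to be wider than \<open>regular\<close>, to which the Bellman iterates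
  belong.\<close>

definition between :: "(real \<Rightarrow> ereal) \<Rightarrow> bool" where
  "between v \<longleftrightarrow> v \<in> borel_measurable borel \<and> (\<forall>x. ereal (bl x) \<le> v x \<and> v x \<le> ereal (bu x))"

definition payoff :: "(real \<Rightarrow> ereal) \<Rightarrow> real \<Rightarrow> 'a \<Rightarrow> 'w \<Rightarrow> real" where
  "payoff v x a w = cost m x a (T x a w) + \<beta> * real_of_ereal (v (T x a w))"

lemma stage_risk_payoff: "stage_risk m \<rho> v x a = \<rho> (payoff v x a)"
  by (simp add: stage_risk_def payoff_def[abs_def] Let_def)

lemma bl_measurable [measurable]: "bl \<in> borel_measurable borel"
  and bu_measurable [measurable]: "bu \<in> borel_measurable borel"
  and bl_nonpos: "bl x \<le> 0" and bu_nonneg: "0 \<le> bu x"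
  using bounds by (auto simp: bounding_pair_def intro: order_trans)

lemma one_le_width: "1 \<le> bu x - bl x"
proof -
  obtain el eu where "el + eu = 1" "bl x \<le> - el" "eu \<le> bu x"
    using bounds by (auto simp: bounding_pair_def)
  then show ?thesis by linarith
qed

lemma discount: "0 < \<beta>" "\<beta> \<le> 1"
  using model by (auto simp: stationary_model_def)

lemma rep_measurable [measurable]: "rep m \<in> M \<rightarrow>\<^sub>M noise m"
  using model by (simp add: stationary_model_def)

lemma rep_space: "w \<in> space M \<Longrightarrow> rep m w \<in> space (noise m)"
  by (rule measurable_space[OF rep_measurable])

lemma in_adm_at_iff [simp]: "a \<in> adm_at m x \<longleftrightarrow> (x, a) \<in> adm m"
  by (simp add: adm_at_def)

lemma adm_at_nonempty: "adm_at m x \<noteq> {}"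
  using model by (auto simp: stationary_model_def adm_at_def)

lemma adm_mono: "x \<le> y \<Longrightarrow> (y, a) \<in> adm m \<Longrightarrow> (x, a) \<in> adm m"
  using M2_decreasing[of x y] by auto

lemma T_mono: "x \<le> y \<Longrightarrow> (y, a) \<in> adm m \<Longrightarrow> w \<in> space M \<Longrightarrow> T x a w \<le> T y a w"
  by (rule M3_incr) (auto intro: rep_space adm_mono)

lemma T_measurable:
  assumes "(x, a) \<in> adm m"
  shows "T x a \<in> borel_measurable M"
proof -
  have "(\<lambda>((x, a), z). trans m x a z) \<in> restrict_space borel (adm m) \<Otimes>\<^sub>M noise m \<rightarrow>\<^sub>M borel"
    using model by (simp add: stationary_model_def)
  moreover have "(\<lambda>w. ((x, a), rep m w)) \<in> M \<rightarrow>\<^sub>M restrict_space borel (adm m) \<Otimes>\<^sub>M noise m"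
    using assms
    by (intro measurable_Pair rep_measurable measurable_const) (simp add: space_restrict_space)
  ultimately have "(\<lambda>w. (\<lambda>((x, a), z). trans m x a z) ((x, a), rep m w)) \<in> borel_measurable M"
    by (rule measurable_compose[rotated])
  then show ?thesis by simp
qed

text \<open>The model does not postulate measurability of \<open>cost\<close>. For a fixed
  admissible pair, monotonicity in the next state supplies it.\<close>

lemma cost_measurable:
  assumes "(x, a) \<in> adm m"
  shows "(\<lambda>w. cost m x a (T x a w)) \<in> borel_measurable M"
  using M4_incr[OF assms assms order_refl]
  by (intro measurable_compose[OF T_measurable[OF assms]] borel_measurable_mono monoI)

lemma between_real:
  assumes "between v"
  shows "v x = ereal (real_of_ereal (v x))" "bl x \<le> real_of_ereal (v x)"
    "real_of_ereal (v x) \<le> bu x" "\<bar>real_of_ereal (v x)\<bar> \<le> bu x - bl x"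
proof -
  have *: "ereal (bl x) \<le> v x" "v x \<le> ereal (bu x)" using assms by (auto simp: between_def)
  then show "v x = ereal (real_of_ereal (v x))" by (cases "v x") auto
  with * show "bl x \<le> real_of_ereal (v x)" "real_of_ereal (v x) \<le> bu x"
    by (metis ereal_less_eq(3))+
  then show "\<bar>real_of_ereal (v x)\<bar> \<le> bu x - bl x"
    using bl_nonpos[of x] bu_nonneg[of x] by linarith
qed

lemma payoff_measurable:
  assumes "between v" "(x, a) \<in> adm m"
  shows "payoff v x a \<in> borel_measurable M"
proof -
  have "(\<lambda>w. v (T x a w)) \<in> borel_measurable M"
    using assms by (intro measurable_compose[OF T_measurable]) (auto simp: between_def)
  then show ?thesis
    unfolding payoff_def[abs_def] using cost_measurable[OF assms(2)] by measurable
qed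

lemma locally_dominatedE:
  assumes "(x, a) \<in> adm m"
  obtains e \<Theta>1 \<Theta>2 where "0 < e" "\<Theta>1 \<in> Lp M p" "\<Theta>2 \<in> Lp M p"
    "\<And>x' a' w. (x', a') \<in> adm m \<Longrightarrow> dist (x, a) (x', a') \<le> e \<Longrightarrow> w \<in> space M \<Longrightarrow>
       \<bar>cost m x' a' (T x' a' w)\<bar> \<le> \<Theta>1 w \<and> bu (T x' a' w) - bl (T x' a' w) \<le> \<Theta>2 w"
proof -
  obtain e \<Theta>1 \<Theta>2 where *: "0 < e" "(\<lambda>w. \<Theta>1 (rep m w)) \<in> Lp M p" "(\<lambda>w. \<Theta>2 (rep m w)) \<in> Lp M p"
    "\<forall>z\<in>space (noise m). \<forall>(x', a')\<in>adm m \<inter> cball (x, a) e.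
       \<bar>cost m x' a' (trans m x' a' z)\<bar> \<le> \<Theta>1 z \<and> bu (trans m x' a' z) - bl (trans m x' a' z) \<le> \<Theta>2 z"
    using dominated[unfolded locally_dominated_def, rule_format, OF assms] by blast
  show thesis
    by (rule that[OF *(1-3)]) (use *(4) rep_space in fastforce)
qed

text \<open>One dominating variable serves all \<open>v\<close> at once: since bl \<le> 0 \<le> bu,
  every such \<open>v\<close> is at most bu - bl in absolute value, which is what the second local
  bound controls.\<close>

lemma payoff_dominated:
  assumes "(x, a) \<in> adm m"
  obtains e Y where "0 < e" "Y \<in> Lp M p"
    "\<And>v x' a' w. between v \<Longrightarrow> (x', a') \<in> adm m \<Longrightarrow> dist (x, a) (x', a') \<le> e \<Longrightarrow> w \<in> space M \<Longrightarrow>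
       \<bar>payoff v x' a' w\<bar> \<le> Y w"
proof -
  obtain e \<Theta>1 \<Theta>2 where *: "0 < e" "\<Theta>1 \<in> Lp M p" "\<Theta>2 \<in> Lp M p"
    "\<And>x' a' w. (x', a') \<in> adm m \<Longrightarrow> dist (x, a) (x', a') \<le> e \<Longrightarrow> w \<in> space M \<Longrightarrow>
       \<bar>cost m x' a' (T x' a' w)\<bar> \<le> \<Theta>1 w \<and> bu (T x' a' w) - bl (T x' a' w) \<le> \<Theta>2 w"
    using locally_dominatedE[OF assms] by blast
  have "\<bar>payoff v x' a' w\<bar> \<le> \<Theta>1 w + \<beta> * \<Theta>2 w"
    if "between v" "(x', a') \<in> adm m" "dist (x, a) (x', a') \<le> e" "w \<in> space M" for v x' a' w
  proof -
    have "\<bar>real_of_ereal (v (T x' a' w))\<bar> \<le> \<Theta>2 w"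
      using between_real(4)[OF that(1), of "T x' a' w"] *(4)[OF that(2-4)] by linarith
    then have "\<beta> * \<bar>real_of_ereal (v (T x' a' w))\<bar> \<le> \<beta> * \<Theta>2 w"
      using discount by (intro mult_left_mono) auto
    moreover have "\<bar>\<beta> * real_of_ereal (v (T x' a' w))\<bar> = \<beta> * \<bar>real_of_ereal (v (T x' a' w))\<bar>"
      using discount by (simp add: abs_mult)
    moreover have "\<bar>cost m x' a' (T x' a' w)\<bar> \<le> \<Theta>1 w" using *(4)[OF that(2-4)] by simp
    ultimately show ?thesis unfolding payoff_def by linarith
  qed
  moreover have "(\<lambda>w. \<Theta>1 w + \<beta> * \<Theta>2 w) \<in> Lp M p"
    using p *(2,3) by (intro Lp_add Lp_scale) auto
  ultimately show thesis using that *(1) by blast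
qed

lemma payoff_Lp:
  assumes v: "between v" and xa: "(x, a) \<in> adm m"
  shows "payoff v x a \<in> Lp M p"
proof -
  obtain e Y where e: "0 < e" and Y: "Y \<in> Lp M p"
    and *: "\<And>v x' a' w. between v \<Longrightarrow> (x', a') \<in> adm m \<Longrightarrow> dist (x, a) (x', a') \<le> e \<Longrightarrow>
       w \<in> space M \<Longrightarrow> \<bar>payoff v x' a' w\<bar> \<le> Y w"
    by (rule payoff_dominated[OF xa], rule that)
  show ?thesis
    by (rule Lp_dominated[OF _ Y payoff_measurable[OF v xa] *[OF v xa]]) (use e p in auto)
qed

lemma state_Lp:
  assumes g: "g \<in> borel_measurable borel" "\<And>x. \<bar>g x\<bar> \<le> bu x - bl x" and xa: "(x, a) \<in> adm m"
  shows "(\<lambda>w. g (T x a w)) \<in> Lp M p"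
proof -
  obtain e \<Theta>1 \<Theta>2 where e: "0 < e" and Y: "\<Theta>2 \<in> Lp M p"
    and *: "\<And>x' a' w. (x', a') \<in> adm m \<Longrightarrow> dist (x, a) (x', a') \<le> e \<Longrightarrow> w \<in> space M \<Longrightarrow>
       \<bar>cost m x' a' (T x' a' w)\<bar> \<le> \<Theta>1 w \<and> bu (T x' a' w) - bl (T x' a' w) \<le> \<Theta>2 w"
    by (rule locally_dominatedE[OF xa], rule that)
  show ?thesis
  proof (rule Lp_dominated[OF _ Y])
    show "(\<lambda>w. g (T x a w)) \<in> borel_measurable M"
      by (rule measurable_compose[OF T_measurable[OF xa] g(1)])
    show "\<bar>g (T x a w)\<bar> \<le> \<Theta>2 w" if "w \<in> space M" for w
      using *[OF xa _ that] g(2)[of "T x a w"] e by simp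
  qed (use p in simp)
qed

lemma \<rho>_mono:
  assumes "X \<in> Lp M p" "Y \<in> Lp M p" "\<And>w. w \<in> space M \<Longrightarrow> X w \<le> Y w"
  shows "\<rho> X \<le> \<rho> Y"
  using monetary[unfolded monetary_def, THEN conjunct1, rule_format, OF assms(1,2) AE_I2] assms(3)
  by blast

lemma stage_risk_mono:
  assumes "between v" "between w" "\<And>x. v x \<le> w x" "(x, a) \<in> adm m"
  shows "stage_risk m \<rho> v x a \<le> stage_risk m \<rho> w x a"
  unfolding stage_risk_payoff
proof (rule \<rho>_mono[OF payoff_Lp payoff_Lp])
  fix s
  have "real_of_ereal (v y) \<le> real_of_ereal (w y)" for y
    using assms(3)[of y] between_real(1)[OF assms(1), of y] between_real(1)[OF assms(2), of y]
    by (metis ereal_less_eq(3))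
  then show "payoff v x a s \<le> payoff w x a s"
    unfolding payoff_def using discount by (intro add_left_mono mult_left_mono) auto
qed (use assms in auto)

definition regular :: "(real \<Rightarrow> ereal) \<Rightarrow> bool" where
  "regular v \<longleftrightarrow> v \<in> lsc_incr_between bl bu"

lemma regular_between: "regular v \<Longrightarrow> between v"
  by (auto simp: regular_def lsc_incr_between_def between_def intro: lsc_on_borel_measurable)

lemma regular_real:
  assumes "regular v"
  shows "lsc_on UNIV (\<lambda>x. ereal (real_of_ereal (v x)))" "mono (\<lambda>x. real_of_ereal (v x))"
proof -
  have "v = (\<lambda>x. ereal (real_of_ereal (v x)))" "mono v" "lsc_on UNIV v"
    using between_real(1)[OF regular_between[OF assms]] assms
    by (auto simp: regular_def lsc_incr_between_def)
  then show "lsc_on UNIV (\<lambda>x. ereal (real_of_ereal (v x)))" by simp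
  from \<open>mono v\<close> show "mono (\<lambda>x. real_of_ereal (v x))"
    using between_real(1)[OF regular_between[OF assms]]
    by (intro monoI) (metis ereal_less_eq(3) monoD)
qed

lemma stage_risk_incr:
  assumes v: "regular v" and "x \<le> y" "(y, a) \<in> adm m"
  shows "stage_risk m \<rho> v x a \<le> stage_risk m \<rho> v y a"
  unfolding stage_risk_payoff
proof (rule \<rho>_mono[OF payoff_Lp payoff_Lp])
  have xa: "(x, a) \<in> adm m" using adm_mono assms by blast
  fix s assume s: "s \<in> space M"
  have le: "T x a s \<le> T y a s" using T_mono assms s by blast
  then have "real_of_ereal (v (T x a s)) \<le> real_of_ereal (v (T y a s))"
    by (rule monoD[OF regular_real(2)[OF v]])
  moreover have "cost m x a (T x a s) \<le> cost m y a (T y a s)"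
    using M4_incr xa assms le by blast
  ultimately show "payoff v x a s \<le> payoff v y a s"
    unfolding payoff_def using discount by (intro add_mono mult_left_mono) auto
qed (use assms regular_between adm_mono in auto)

lemma payoff_eventually:
  assumes v: "regular v" and xa: "(x, a) \<in> adm m" and ub: "\<And>k. (u k, b k) \<in> adm m"
    and lim: "(\<lambda>k. (u k, b k)) \<longlonglongrightarrow> (x, a)" and w: "w \<in> space M" and "0 < e"
  shows "\<forall>\<^sub>F k in sequentially. payoff v x a w - e < payoff v (u k) (b k) w"
proof -
  let ?z = "rep m w"
  \<comment> \<open>The transition may stay above its limit value along the sequence. Lower
    semicontinuity excludes undershooting and the cap excludes overshooting, so cost and
    \<open>v\<close> can be evaluated at convergent arguments.\<close>
  define t where "t k = min (T (u k) (b k) w) (T x a w)" for k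
  have z: "?z \<in> space (noise m)" using rep_space[OF w] .
  have "lsc_on (adm m) (\<lambda>xa. ereal ((\<lambda>(x, a). trans m x a ?z) xa))"
    using M3_lsc[OF z] by (simp add: case_prod_unfold)
  from lsc_on_real_eventually[OF this xa ub lim]
  have T: "\<forall>\<^sub>F k in sequentially. T x a w - d < T (u k) (b k) w" if "0 < d" for d
    using that by simp
  have t: "t \<longlonglongrightarrow> T x a w"
  proof (rule LIMSEQ_I)
    fix d :: real assume d: "0 < d"
    from T[OF d] obtain N where N: "\<And>k. N \<le> k \<Longrightarrow> T x a w - d < T (u k) (b k) w"
      by (auto simp: eventually_sequentially)
    then have "norm (t k - T x a w) < d" if "N \<le> k" for k
      using N[OF that] d by (auto simp: t_def min_def)
    then show "\<exists>N. \<forall>k\<ge>N. norm (t k - T x a w) < d" by blast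
  qed
  have ub_lim: "u \<longlonglongrightarrow> x" "b \<longlonglongrightarrow> a"
    using tendsto_fst[OF lim] tendsto_snd[OF lim] by auto
  have "lsc_on {(x, a, x'). (x, a) \<in> adm m} (\<lambda>y. ereal ((\<lambda>(x, a, x'). cost m x a x') y))"
    using M4_lsc by (simp add: case_prod_unfold)
  from lsc_on_real_eventually[OF this, of "(x, a, T x a w)" "\<lambda>k. (u k, b k, t k)" "e/2"]
  have c: "\<forall>\<^sub>F k in sequentially. cost m x a (T x a w) - e/2 < cost m (u k) (b k) (t k)"
    using xa ub \<open>0 < e\<close> tendsto_Pair[OF ub_lim(1) tendsto_Pair[OF ub_lim(2) t]] by simp
  from lsc_on_real_eventually[OF regular_real(1)[OF v] _ _ t, of "e/2"]
  have v': "\<forall>\<^sub>F k in sequentially.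
      real_of_ereal (v (T x a w)) - e/2 < real_of_ereal (v (t k))"
    using \<open>0 < e\<close> by simp
  show ?thesis
    using c v'
  proof eventually_elim
    case (elim k)
    have le: "t k \<le> T (u k) (b k) w" by (simp add: t_def)
    have "cost m (u k) (b k) (t k) \<le> cost m (u k) (b k) (T (u k) (b k) w)"
      using M4_incr[OF ub ub order_refl le] .
    moreover have "\<beta> * (real_of_ereal (v (T x a w)) - e/2)
        \<le> \<beta> * real_of_ereal (v (T (u k) (b k) w))"
      using discount elim(2) monoD[OF regular_real(2)[OF v] le] by (intro mult_left_mono) auto
    \<comment> \<open>Because of \<beta> \<le> 1 the continuation loses at most e/2; the cost loses
      the other half.\<close>
    moreover have "\<beta> * (e/2) \<le> 1 * (e/2)" using discount \<open>0 < e\<close> by (intro mult_right_mono) auto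
    ultimately show ?case using elim(1) unfolding payoff_def by (simp add: algebra_simps)
  qed
qed

lemma stage_risk_lsc:
  assumes v: "regular v"
  shows "lsc_on {(x, a). a \<in> adm_at m x} (\<lambda>(x, a). stage_risk m \<rho> v x a)"
  unfolding lsc_on_def
proof (intro ballI allI impI)
  fix xa :: "real \<times> 'a" and ub :: "nat \<Rightarrow> real \<times> 'a"
  assume xa: "xa \<in> {(x, a). a \<in> adm_at m x}" and ub: "\<forall>k. ub k \<in> {(x, a). a \<in> adm_at m x}"
    and lim: "ub \<longlonglongrightarrow> xa"
  obtain x a where [simp]: "xa = (x, a)" by (cases xa)
  define u b where "u k = fst (ub k)" and "b k = snd (ub k)" for k
  have ub_eq: "ub k = (u k, b k)" for k by (simp add: u_def b_def)
  have xa: "(x, a) \<in> adm m" and uba: "(u k, b k) \<in> adm m" for k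
    using xa ub[rule_format, of k] ub_eq[of k] by auto
  have bv: "between v" using regular_between[OF v] .
  obtain e Y where eY: "0 < e" "Y \<in> Lp M p"
    "\<And>v x' a' w. between v \<Longrightarrow> (x', a') \<in> adm m \<Longrightarrow> dist (x, a) (x', a') \<le> e \<Longrightarrow> w \<in> space M \<Longrightarrow>
       \<bar>payoff v x' a' w\<bar> \<le> Y w"
    by (rule payoff_dominated[OF xa], rule that)
  have lim': "(\<lambda>k. (u k, b k)) \<longlonglongrightarrow> (x, a)" using lim by (simp add: u_def b_def)
  \<comment> \<open>The domination is local, so the sequence is shifted until it stays in the ball;
    the lower limit does not see the shift.\<close>
  from tendstoD[OF this eY(1)] obtain N where N: "\<And>k. N \<le> k \<Longrightarrow> dist (x, a) (u k, b k) \<le> e"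
    unfolding eventually_sequentially by (metis dist_commute less_imp_le)
  have "stage_risk m \<rho> v x a \<le> liminf (\<lambda>k. stage_risk m \<rho> v (u (k + N)) (b (k + N)))"
    unfolding stage_risk_payoff
  proof (rule Fatou_property_liminf[OF _ monetary Fatou eY(2)])
    show "payoff v x a \<in> Lp M p" using payoff_Lp[OF bv xa] .
    show "payoff v (u (k + N)) (b (k + N)) \<in> borel_measurable M" for k
      using payoff_measurable[OF bv uba] .
    show "\<bar>payoff v (u (k + N)) (b (k + N)) w\<bar> \<le> Y w" if "w \<in> space M" for k w
      using eY(3)[OF bv uba N that] by simp
    show "\<bar>payoff v x a w\<bar> \<le> Y w" if "w \<in> space M" for w
      using eY(3)[OF bv xa _ that] eY(1) by simp
    show "\<forall>\<^sub>F k in sequentially. payoff v x a w - d < payoff v (u (k + N)) (b (k + N)) w"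
      if "w \<in> space M" "0 < d" for w d
      using payoff_eventually[OF v xa uba LIMSEQ_ignore_initial_segment[OF lim'] that] .
  qed (use p in auto)
  also have "\<dots> = liminf (\<lambda>k. stage_risk m \<rho> v (u k) (b k))"
    by (rule liminf_shift_k)
  finally show "(case xa of (x, a) \<Rightarrow> stage_risk m \<rho> v x a)
      \<le> liminf (\<lambda>k. case ub k of (x, a) \<Rightarrow> stage_risk m \<rho> v x a)"
    by (simp add: ub_eq)
qed

lemma bellman_op_lsc: "regular v \<Longrightarrow> lsc_on UNIV (bellman_op m \<rho> v)"
  using lsc_on_INF_usc_correspondence[OF M2_usc closed_UNIV stage_risk_lsc, of v]
  by (simp add: bellman_op_def[abs_def])

text \<open>Since the action sets decrease, every action at the larger state is also available at
  the smaller one, where its stage risk is at most as large.\<close>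

lemma bellman_op_mono:
  assumes "regular v"
  shows "mono (bellman_op m \<rho> v)"
proof (rule monoI)
  fix x y :: real assume le: "x \<le> y"
  show "bellman_op m \<rho> v x \<le> bellman_op m \<rho> v y"
    unfolding bellman_op_def
  proof (rule INF_mono)
    fix a assume "a \<in> adm_at m y"
    then show "\<exists>a'\<in>adm_at m x. stage_risk m \<rho> v x a' \<le> stage_risk m \<rho> v y a"
      using stage_risk_incr[OF assms le] adm_mono[OF le] by (intro bexI[of _ a]) auto
  qed
qed

lemma minimizer_exists:
  assumes "regular v"
  obtains d where "d \<in> markov_rules m" "rule_op m \<rho> d v = bellman_op m \<rho> v"
proof -
  obtain d where d: "d \<in> borel_measurable borel" "\<And>x. d x \<in> adm_at m x"
    "\<And>x. stage_risk m \<rho> v x (d x) = (INF a\<in>adm_at m x. stage_risk m \<rho> v x a)"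
    using lsc_measurable_minimizer[OF M2_usc adm_at_nonempty stage_risk_lsc[OF assms]] by blast
  show thesis
    by (rule that[of d]) (use d in \<open>auto simp: markov_rules_def rule_op_def bellman_op_def\<close>)
qed

lemma bellman_op_le: "(x, a) \<in> adm m \<Longrightarrow> bellman_op m \<rho> v x \<le> stage_risk m \<rho> v x a"
  unfolding bellman_op_def by (rule INF_lower) simp

lemma regular_zero: "regular (\<lambda>_. 0)"
  using bl_nonpos bu_nonneg
  by (auto simp: regular_def lsc_incr_between_def lsc_on_def mono_def Liminf_const zero_ereal_def)

end

section \<open>Finite horizon\<close>

lemma space_hist_space: "space (hist_space m n) = (\<Pi>\<^sub>E k\<in>{..<n}. adm m) \<times> UNIV"
  by (simp add: hist_space_def space_pair_measure space_PiM space_restrict_space)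

lemma extend_hist_in_space:
  assumes "h \<in> space (hist_space m n)" "(snd h, a) \<in> adm m"
  shows "extend_hist n h a x' \<in> space (hist_space m (Suc n))"
proof -
  have "fst h \<in> (\<Pi>\<^sub>E k\<in>{..<n}. adm m)"
    using assms(1) unfolding space_hist_space by (simp only: mem_Times_iff)
  then have "(fst h)(n := (snd h, a)) \<in> (\<Pi>\<^sub>E k\<in>insert n {..<n}. adm m)"
    using assms(2) by (intro PiE_fun_upd)
  then show ?thesis
    by (simp add: space_hist_space extend_hist_def mem_Times_iff lessThan_Suc)
qed

lemma extend_hist_measurable:
  assumes "h \<in> space (hist_space m n)" "(snd h, a) \<in> adm m"
  shows "extend_hist n h a \<in> borel \<rightarrow>\<^sub>M hist_space m (Suc n)"
proof -
  have "(fst h)(n := (snd h, a)) \<in> space (\<Pi>\<^sub>M k\<in>{..<Suc n}. restrict_space borel (adm m))"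
    using extend_hist_in_space[OF assms] by (simp add: hist_space_def extend_hist_def space_pair_measure)
  then show ?thesis
    unfolding hist_space_def extend_hist_def[abs_def]
    by (intro measurable_Pair measurable_const measurable_ident_sets) auto
qed

text \<open>Turns bounds stated along histories into bounds at every state. The past is filled with
  the state 0 and the action that the given measurable selector takes there.\<close>

lemma history_exists:
  assumes "stationary_model m"
  shows "\<exists>h\<in>space (hist_space m n). snd h = x"
proof -
  obtain f where "\<And>x. (x, f x) \<in> adm m" using assms by (auto simp: stationary_model_def)
  then show ?thesis
    by (intro bexI[of _ "(\<lambda>k\<in>{..<n}. (0, f 0), x)"])
      (simp_all add: space_hist_space)
qed

lemma policy_value_rec:
  assumes "n < N"
  shows "policy_value m \<rho> N n \<pi> h =
    stage_risk m \<rho> (\<lambda>x'. policy_value m \<rho> N (Suc n) \<pi> (extend_hist n h (\<pi> n h) x')) (snd h) (\<pi> n h)"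
proof -
  have "N - n = Suc (N - Suc n)" using assms by simp
  then show ?thesis by (simp only: policy_value_def value_to_go.simps Let_def)
qed

locale finite_horizon_mdp = risk_mdp m p \<rho> bl bu
  for m :: "('w, 'z, 'a::polish_space) decision_model" and p \<rho> bl bu +
  fixes N :: nat
  assumes policy_value_measurable: "\<And>\<pi> n. \<pi> \<in> policies m (enat N) \<Longrightarrow> n \<le> N \<Longrightarrow>
      policy_value m \<rho> N n \<pi> \<in> borel_measurable (hist_space m n)"
    and policy_value_bounds: "\<And>\<pi> n h. \<pi> \<in> policies m (enat N) \<Longrightarrow> n \<le> N \<Longrightarrow>
      h \<in> space (hist_space m n) \<Longrightarrow>
      ereal (bl (snd h)) \<le> policy_value m \<rho> N n \<pi> h \<and> policy_value m \<rho> N n \<pi> h \<le> ereal (bu (snd h))"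
begin

text \<open>The candidate for both value functions. The index is the time, so N - n stages
  remain.\<close>

definition W :: "nat \<Rightarrow> real \<Rightarrow> ereal" where
  "W n = (bellman_op m \<rho> ^^ (N - n)) (\<lambda>_. 0)"

lemma W_N: "W N = (\<lambda>_. 0)"
  by (simp add: W_def)

lemma W_rec: "n < N \<Longrightarrow> W n = bellman_op m \<rho> (W (Suc n))"
  by (simp add: W_def flip: Suc_diff_Suc)

lemma policy_admissible:
  "\<pi> \<in> policies m (enat N) \<Longrightarrow> n < N \<Longrightarrow> h \<in> space (hist_space m n) \<Longrightarrow> (snd h, \<pi> n h) \<in> adm m"
  by (auto simp: policies_def decision_rules_def)

lemma continuation_between:
  assumes "\<pi> \<in> policies m (enat N)" "n < N" "h \<in> space (hist_space m n)" "(snd h, a) \<in> adm m"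
  shows "between (\<lambda>x'. policy_value m \<rho> N (Suc n) \<pi> (extend_hist n h a x'))"
proof -
  have "(\<lambda>x'. policy_value m \<rho> N (Suc n) \<pi> (extend_hist n h a x')) \<in> borel_measurable borel"
    using assms by (intro measurable_compose[OF extend_hist_measurable policy_value_measurable]) auto
  moreover have "snd (extend_hist n h a x') = x'" for x' by (simp add: extend_hist_def)
  ultimately show ?thesis
    using policy_value_bounds[OF assms(1) _ extend_hist_in_space[OF assms(3,4)]] assms(2)
    by (simp add: between_def)
qed

text \<open>Backward induction that only unfolds the value recursion. It is thus available before
  any bound on \<open>W\<close> is known, and the next lemma uses it to obtain these bounds. Rules
  before time n are unconstrained beyond being Markov rules.\<close>

lemma policy_value_minimizers:
  assumes d: "d \<in> markov_policies m (enat N)" and "n \<le> N"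
    and "\<And>k. n \<le> k \<Longrightarrow> k < N \<Longrightarrow> rule_op m \<rho> (d k) (W (Suc k)) = W k"
    and "h \<in> space (hist_space m n)"
  shows "policy_value m \<rho> N n (as_policy d) h = W n (snd h)"
  using assms(2-4)
proof (induction arbitrary: h rule: inc_induct)
  case base
  show ?case by (simp add: W_N policy_value_def)
next
  case (step n)
  have "(snd h, d n (snd h)) \<in> adm m"
    using policy_admissible[OF as_policy_in_policies[OF d] step.hyps(2) step.prems(2)]
    by (simp add: as_policy_def)
  then have "policy_value m \<rho> N (Suc n) (as_policy d) (extend_hist n h (d n (snd h)) x') = W (Suc n) x'" for x'
    using step.IH[OF step.prems(1) extend_hist_in_space[OF step.prems(2)]]
    by (simp add: extend_hist_def)
  then have "policy_value m \<rho> N n (as_policy d) h = rule_op m \<rho> (d n) (W (Suc n)) (snd h)"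
    by (simp add: policy_value_rec[OF step.hyps(2)] as_policy_def rule_op_def)
  then show ?case using step.prems(1)[of n] step.hyps by simp
qed

text \<open>Minimizers and regularity have to be produced together: a minimizer at time n requires
  \<open>W (Suc n)\<close> to be regular, while the bounds on \<open>W n\<close> are those assumed
  for policy values, applied to the policy that has just been extended by this minimizer.\<close>

lemma minimizing_policy_exists:
  assumes "n \<le> N"
  shows "\<exists>d\<in>markov_policies m (enat N). \<forall>k\<ge>n.
    (k < N \<longrightarrow> rule_op m \<rho> (d k) (W (Suc k)) = W k) \<and> (k \<le> N \<longrightarrow> regular (W k))"
  using assms
proof (induction rule: inc_induct)
  case base
  \<comment> \<open>Only some Markov rule is wanted here, and a minimizer for the zero function is
    one.\<close>
  obtain d where "d \<in> markov_rules m"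
    using minimizer_exists[OF regular_zero] by blast
  then have "(\<lambda>_. d) \<in> markov_policies m (enat N)" by (simp add: markov_policies_def)
  then show ?case using regular_zero by (intro bexI[of _ "\<lambda>_. d"]) (auto simp: W_N)
next
  case (step n)
  then obtain d where d: "d \<in> markov_policies m (enat N)"
    "\<And>k. Suc n \<le> k \<Longrightarrow> k < N \<Longrightarrow> rule_op m \<rho> (d k) (W (Suc k)) = W k"
    "\<And>k. Suc n \<le> k \<Longrightarrow> k \<le> N \<Longrightarrow> regular (W k)" by blast
  have reg: "regular (W (Suc n))" using d(3) step.hyps by simp
  then obtain d' where d': "d' \<in> markov_rules m"
    "rule_op m \<rho> d' (W (Suc n)) = bellman_op m \<rho> (W (Suc n))"
    using minimizer_exists by blast
  define e where "e = d(n := d')"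
  have mp: "e \<in> markov_policies m (enat N)" using d(1) d'(1) by (auto simp: markov_policies_def e_def)
  have min: "rule_op m \<rho> (e k) (W (Suc k)) = W k" if "n \<le> k" "k < N" for k
    using that d(2)[of k] d'(2) W_rec by (cases "k = n") (auto simp: e_def)
  have "ereal (bl x) \<le> W n x \<and> W n x \<le> ereal (bu x)" for x
  proof -
    obtain h where h: "h \<in> space (hist_space m n)" "snd h = x"
      using history_exists[OF model] by blast
    have "policy_value m \<rho> N n (as_policy e) h = W n x"
      using policy_value_minimizers[OF mp _ min h(1)] step.hyps h(2) by simp
    then show ?thesis
      using policy_value_bounds[OF as_policy_in_policies[OF mp] _ h(1)] step.hyps h(2) by simp
  qed
  then have "regular (W n)"
    using bellman_op_lsc[OF reg] bellman_op_mono[OF reg] W_rec[OF step.hyps(2)]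
    by (simp add: regular_def lsc_incr_between_def)
  then have "\<forall>k\<ge>n. (k < N \<longrightarrow> rule_op m \<rho> (e k) (W (Suc k)) = W k) \<and> (k \<le> N \<longrightarrow> regular (W k))"
    using min d(3) by (metis not_less_eq_eq le_antisym)
  with mp show ?case by blast
qed

lemma W_regular: "n \<le> N \<Longrightarrow> regular (W n)"
  using minimizing_policy_exists[of n] by blast

text \<open>Dependence on the past brings no gain: once the history and the action are fixed, the
  continuation of any policy is a function of the next state alone. By induction it dominates
  \<open>W (Suc n)\<close>, and the stage risk is monotone.\<close>

lemma W_le_policy_value:
  assumes \<pi>: "\<pi> \<in> policies m (enat N)" and "n \<le> N" and "h \<in> space (hist_space m n)"
  shows "W n (snd h) \<le> policy_value m \<rho> N n \<pi> h"
  using assms(2,3)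
proof (induction arbitrary: h rule: inc_induct)
  case base
  show ?case by (simp add: W_N policy_value_def)
next
  case (step n)
  let ?v = "\<lambda>x'. policy_value m \<rho> N (Suc n) \<pi> (extend_hist n h (\<pi> n h) x')"
  have a: "(snd h, \<pi> n h) \<in> adm m" using policy_admissible[OF \<pi> step.hyps(2) step.prems] .
  have "W n (snd h) \<le> stage_risk m \<rho> (W (Suc n)) (snd h) (\<pi> n h)"
    using bellman_op_le[OF a] W_rec[OF step.hyps(2)] by simp
  also have "\<dots> \<le> stage_risk m \<rho> ?v (snd h) (\<pi> n h)"
  proof (rule stage_risk_mono[OF _ _ _ a])
    show "between (W (Suc n))" using W_regular[of "Suc n"] step.hyps regular_between by simp
    show "between ?v" using continuation_between[OF \<pi> step.hyps(2) step.prems a] .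
    show "W (Suc n) x \<le> ?v x" for x
      using step.IH[OF extend_hist_in_space[OF step.prems a, of x]] by (simp add: extend_hist_def)
  qed
  also have "\<dots> = policy_value m \<rho> N n \<pi> h" by (simp add: policy_value_rec[OF step.hyps(2)])
  finally show ?case .
qed

lemma markov_value_eq:
  assumes "n \<le> N"
  shows "markov_value m \<rho> N n = W n"
proof (rule ext, rule antisym)
  fix x
  obtain d where d: "d \<in> markov_policies m (enat N)"
    "\<And>k. n \<le> k \<Longrightarrow> k < N \<Longrightarrow> rule_op m \<rho> (d k) (W (Suc k)) = W k"
    using minimizing_policy_exists[OF assms] by blast
  obtain h where h: "h \<in> space (hist_space m n)" "snd h = x"
    using history_exists[OF model] by blast
  have "policy_value m \<rho> N n (as_policy d) h = W n x"
    using policy_value_minimizers[OF d(1) assms d(2) h(1)] h(2) by simp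
  then show "markov_value m \<rho> N n x \<le> W n x"
    unfolding markov_value_def using d(1) h
    by (intro Inf_lower CollectI exI[of _ d] exI[of _ h] conjI) simp_all
  show "W n x \<le> markov_value m \<rho> N n x"
    unfolding markov_value_def
    using W_le_policy_value[OF as_policy_in_policies assms] by (intro Inf_greatest) blast
qed

lemma opt_value_eq:
  assumes "n \<le> N" "h \<in> space (hist_space m n)"
  shows "opt_value m \<rho> N n h = W n (snd h)"
proof (rule antisym)
  obtain d where d: "d \<in> markov_policies m (enat N)"
    "\<And>k. n \<le> k \<Longrightarrow> k < N \<Longrightarrow> rule_op m \<rho> (d k) (W (Suc k)) = W k"
    using minimizing_policy_exists[OF assms(1)] by blast
  show "opt_value m \<rho> N n h \<le> W n (snd h)"
    unfolding opt_value_def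
    using policy_value_minimizers[OF d(1) assms(1) d(2) assms(2)]
    by (intro INF_lower2[OF as_policy_in_policies[OF d(1)]]) simp
  show "W n (snd h) \<le> opt_value m \<rho> N n h"
    unfolding opt_value_def using W_le_policy_value assms by (intro INF_greatest)
qed

end

section \<open>Infinite horizon\<close>

lemma J_pol_0: "J_pol m \<rho> d 0 = (\<lambda>_. 0)"
  by (simp add: J_pol_def)

text \<open>The recursion removes the first rule and shifts the others, so inductions on the number
  of stages must leave the policy arbitrary.\<close>

lemma J_pol_Suc: "J_pol m \<rho> d (Suc n) = rule_op m \<rho> (d 0) (J_pol m \<rho> (\<lambda>k. d (Suc k)) n)"
proof -
  have "[0..<Suc n] = 0 # map Suc [0..<n]" by (simp add: upt_conv_Cons map_Suc_upt del: upt_Suc)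
  then show ?thesis unfolding J_pol_def by (simp add: foldr_map o_def del: upt_Suc)
qed

lemma markov_policies_shift:
  "d \<in> markov_policies m \<infinity> \<Longrightarrow> (\<lambda>k. d (Suc k)) \<in> markov_policies m \<infinity>"
  by (auto simp: markov_policies_def)

text \<open>Two additive inequalities replace an absolute difference: they make sense for extended
  reals and are the form in which the one-sided contractions deliver their estimates.\<close>

lemma ereal_tendsto_geometric:
  fixes X :: "nat \<Rightarrow> ereal"
  assumes g: "0 \<le> g" "g < 1"
    and "\<And>n. X n \<le> ereal L + ereal (g ^ n * c)" "\<And>n. ereal L \<le> X n + ereal (g ^ n * c)"
  shows "X \<longlonglongrightarrow> ereal L"
proof (rule tendsto_sandwich)
  have g0: "(\<lambda>n. g ^ n * c) \<longlonglongrightarrow> 0"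
    using tendsto_mult_right[OF LIMSEQ_realpow_zero[OF g], of c] by simp
  show "(\<lambda>n. ereal (L - g ^ n * c)) \<longlonglongrightarrow> ereal L"
    using tendsto_diff[OF tendsto_const g0, of L] by simp
  show "(\<lambda>n. ereal (L + g ^ n * c)) \<longlonglongrightarrow> ereal L"
    using tendsto_add[OF tendsto_const g0, of L] by simp
  show "\<forall>\<^sub>F n in sequentially. X n \<le> ereal (L + g ^ n * c)"
    using assms(3) by simp
  have "ereal (L - g ^ n * c) \<le> X n" for n
    using assms(4)[of n] by (cases "X n") auto
  then show "\<forall>\<^sub>F n in sequentially. ereal (L - g ^ n * c) \<le> X n" by simp
qed

lemma geometric_Cauchy_limit:
  fixes r :: "nat \<Rightarrow> real"
  assumes g: "0 \<le> g" "g < 1" and r: "\<And>n k. \<bar>r (n + k) - r n\<bar> \<le> g ^ n * c"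
  obtains L where "\<And>n. \<bar>L - r n\<bar> \<le> g ^ n * c" "r \<longlonglongrightarrow> L"
proof -
  have g0: "(\<lambda>n. g ^ n * c) \<longlonglongrightarrow> 0"
    using tendsto_mult_right[OF LIMSEQ_realpow_zero[OF g], of c] by simp
  have "Cauchy r"
  proof (rule CauchyI')
    fix e :: real assume "0 < e"
    from order_tendstoD(2)[OF g0 this] obtain N where N: "\<And>n. N \<le> n \<Longrightarrow> g ^ n * c < e"
      by (auto simp: eventually_sequentially)
    have "dist (r n) (r k) < e" if "N \<le> n" "n < k" for n k
      using r[of n "k - n"] N[OF that(1)] that(2) by (simp add: dist_real_def abs_minus_commute)
    then show "\<exists>M. \<forall>m\<ge>M. \<forall>n>m. dist (r m) (r n) < e" by blast
  qed
  then obtain L where L: "r \<longlonglongrightarrow> L" using Cauchy_convergent convergent_def by blast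
  have "\<bar>L - r n\<bar> \<le> g ^ n * c" for n
  proof (rule tendsto_upperbound)
    show "(\<lambda>k. \<bar>r (k + n) - r n\<bar>) \<longlonglongrightarrow> \<bar>L - r n\<bar>"
      using L by (intro tendsto_intros LIMSEQ_ignore_initial_segment)
    show "\<forall>\<^sub>F k in sequentially. \<bar>r (k + n) - r n\<bar> \<le> g ^ n * c"
      using r[of n] by (simp add: add.commute)
  qed simp
  with L show thesis using that by blast
qed

lemma ereal_geometric_Cauchy_limit:
  fixes X :: "nat \<Rightarrow> ereal"
  assumes g: "0 \<le> g" "g < 1" and fin: "\<And>n. \<bar>X n\<bar> \<noteq> \<infinity>"
    and up: "\<And>n k. X (n + k) \<le> X n + ereal (g ^ n * c)"
    and lo: "\<And>n k. X n \<le> X (n + k) + ereal (g ^ n * c)"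
  obtains L where "\<And>n. X n \<le> ereal L + ereal (g ^ n * c)" "\<And>n. ereal L \<le> X n + ereal (g ^ n * c)"
    "X \<longlonglongrightarrow> ereal L"
proof -
  define r where "r n = real_of_ereal (X n)" for n
  have X: "X n = ereal (r n)" for n unfolding r_def using fin[of n] by (simp add: ereal_real')
  have "\<bar>r (n + k) - r n\<bar> \<le> g ^ n * c" for n k
    using up[of n k] lo[of n k] unfolding X by (auto simp: abs_le_iff)
  then obtain L where L: "\<And>n. \<bar>L - r n\<bar> \<le> g ^ n * c" "r \<longlonglongrightarrow> L"
    using geometric_Cauchy_limit[OF g] by blast
  show thesis
  proof (rule that)
    show "X n \<le> ereal L + ereal (g ^ n * c)" "ereal L \<le> X n + ereal (g ^ n * c)" for n
      using L(1)[of n] unfolding X by (auto simp: abs_le_iff)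
    show "X \<longlonglongrightarrow> ereal L" unfolding X using L(2) by simp
  qed
qed

text \<open>Will pass estimates for the lower bound to its increasing majorant. For positive c
  division by c bounds the family; c = 0 is treated apart since the growth constant \<alpha> may
  vanish.\<close>

lemma mult_SUP_le_ereal:
  fixes f :: "'b \<Rightarrow> real"
  assumes c: "0 \<le> c" and A: "A \<noteq> {}" and le: "\<And>y. y \<in> A \<Longrightarrow> ereal (c * f y) \<le> E"
  shows "ereal (c * (SUP y\<in>A. f y)) \<le> E"
proof (cases "c = 0")
  case True
  then show ?thesis using le A by auto
next
  case False
  with c have c: "0 < c" by simp
  show ?thesis
  proof (cases E)
    case (real r)
    have "f y \<le> r / c" if "y \<in> A" for y
      using le[OF that] real c by (simp add: field_simps)
    then have "(SUP y\<in>A. f y) \<le> r / c" using A by (intro cSUP_least)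
    then show ?thesis using real c by (simp add: field_simps)
  qed (use le A in auto)
qed

text \<open>Here \<open>bl\<close> and \<open>bu\<close> stand for the bounds already divided by 1 -
  \<alpha>\<beta>, whence this factor in the cost bounds. It makes the band between them invariant:
  (1 - \<alpha>\<beta>) bu + \<alpha>\<beta> bu = bu, and likewise for \<open>bl\<close>.\<close>

locale discounted_mdp = risk_mdp m p \<rho> bl bu
  for m :: "('w, 'z, 'a::polish_space) decision_model" and p \<rho> bl bu +
  fixes \<alpha> :: real
  assumes \<alpha>: "0 \<le> \<alpha>" and \<alpha>_discount: "\<alpha> * discount m < 1"
    and coherent: "coherent (prob m) p \<rho>"
    and cost_bounds: "\<And>x a. (x, a) \<in> adm m \<Longrightarrow>
      ereal ((1 - \<alpha> * discount m) * bl x) \<le> \<rho> (\<lambda>w. cost m x a (trans m x a (rep m w))) \<and>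
      \<rho> (\<lambda>w. cost m x a (trans m x a (rep m w))) \<le> ereal ((1 - \<alpha> * discount m) * bu x)"
    and growth_lower: "\<And>x a. (x, a) \<in> adm m \<Longrightarrow>
      \<rho> (\<lambda>w. - bl (trans m x a (rep m w))) \<le> ereal (\<alpha> * - bl x)"
    and growth_upper: "\<And>x a. (x, a) \<in> adm m \<Longrightarrow>
      \<rho> (\<lambda>w. bu (trans m x a (rep m w))) \<le> ereal (\<alpha> * bu x)"
    and J_pol_measurable: "\<And>d n. d \<in> markov_policies m \<infinity> \<Longrightarrow>
      J_pol m \<rho> d n \<in> borel_measurable borel"
begin

abbreviation "\<gamma> \<equiv> \<alpha> * \<beta>"

lemma \<gamma>: "0 \<le> \<gamma>" "\<gamma> < 1"
  using \<alpha> \<alpha>_discount discount by auto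

lemma \<rho>_subadditive:
  "X \<in> Lp M p \<Longrightarrow> Y \<in> Lp M p \<Longrightarrow> \<rho> (\<lambda>w. X w + Y w) \<le> \<rho> X + \<rho> Y"
  using coherent by (simp add: coherent_def)

lemma \<rho>_scale: "X \<in> Lp M p \<Longrightarrow> 0 \<le> l \<Longrightarrow> \<rho> (\<lambda>w. l * X w) = ereal l * \<rho> X"
  using coherent by (simp add: coherent_def)

text \<open>A weight is a function with respect to which the one-step operators are one-sided
  contractions with modulus \<open>\<alpha> * \<beta>\<close>.\<close>

definition weight :: "(real \<Rightarrow> real) \<Rightarrow> bool" where
  "weight g \<longleftrightarrow> g \<in> borel_measurable borel \<and> (\<forall>x. 0 \<le> g x \<and> g x \<le> bu x - bl x) \<and>
     (\<forall>(x, a)\<in>adm m. \<rho> (\<lambda>w. g (T x a w)) \<le> ereal (\<alpha> * g x))"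

lemma weight_Lp: "weight g \<Longrightarrow> (x, a) \<in> adm m \<Longrightarrow> (\<lambda>w. g (T x a w)) \<in> Lp M p"
  by (rule state_Lp) (auto simp: weight_def)

lemma weight_neg_bl: "weight (\<lambda>x. - bl x)"
  using growth_lower bl_nonpos bu_nonneg by (auto simp: weight_def)

lemma weight_bu: "weight bu"
  using growth_upper bl_nonpos bu_nonneg by (auto simp: weight_def)

lemma weight_width: "weight (\<lambda>x. bu x - bl x)"
proof -
  have "\<rho> (\<lambda>w. bu (T x a w) - bl (T x a w)) \<le> ereal (\<alpha> * (bu x - bl x))" if "(x, a) \<in> adm m" for x a
  proof -
    have "\<rho> (\<lambda>w. bu (T x a w) + - bl (T x a w)) \<le> \<rho> (\<lambda>w. bu (T x a w)) + \<rho> (\<lambda>w. - bl (T x a w))"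
      using weight_Lp[OF weight_bu that] weight_Lp[OF weight_neg_bl that] by (rule \<rho>_subadditive)
    also have "\<dots> \<le> ereal (\<alpha> * bu x) + ereal (\<alpha> * - bl x)"
      using growth_lower[OF that] growth_upper[OF that] by (intro add_mono)
    finally show ?thesis by (simp add: algebra_simps)
  qed
  moreover have "0 \<le> bu x - bl x" for x using one_le_width[of x] by simp
  ultimately show ?thesis by (auto simp: weight_def)
qed

text \<open>Monotonicity, then subadditivity, then positive homogeneity extract the error \<beta> K
  g(T) from the risk, and the growth condition on \<open>g\<close> turns its risk into a multiple of
  g(x). Subadditivity gives only this direction; the other one follows by exchanging
  \<open>v\<close> and \<open>w\<close>.\<close>

lemma stage_risk_contraction:
  assumes g: "weight g" and v: "between v" and w: "between w" and K: "0 \<le> K"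
    and le: "\<And>x. v x \<le> w x + ereal (K * g x)" and xa: "(x, a) \<in> adm m"
  shows "stage_risk m \<rho> v x a \<le> stage_risk m \<rho> w x a + ereal (\<gamma> * K * g x)"
proof -
  let ?G = "\<lambda>s. g (T x a s)"
  note GLp = weight_Lp[OF g xa]
  have \<beta>K: "0 \<le> \<beta> * K" using K discount by simp
  have "payoff v x a s \<le> payoff w x a s + \<beta> * K * ?G s" for s
  proof -
    have "real_of_ereal (v y) \<le> real_of_ereal (w y) + K * g y" for y
      using le[of y] between_real(1)[OF v, of y] between_real(1)[OF w, of y]
      by (metis ereal_less_eq(3) plus_ereal.simps(1))
    then have "\<beta> * real_of_ereal (v (T x a s)) \<le> \<beta> * (real_of_ereal (w (T x a s)) + K * ?G s)"
      using discount by (intro mult_left_mono) auto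
    then show ?thesis by (simp add: payoff_def algebra_simps)
  qed
  then have "\<rho> (payoff v x a) \<le> \<rho> (\<lambda>s. payoff w x a s + \<beta> * K * ?G s)"
    using p by (intro \<rho>_mono payoff_Lp Lp_add Lp_scale v w xa GLp) auto
  also have "\<dots> \<le> \<rho> (payoff w x a) + \<rho> (\<lambda>s. \<beta> * K * ?G s)"
    by (intro \<rho>_subadditive payoff_Lp Lp_scale w xa GLp)
  also have "\<rho> (\<lambda>s. \<beta> * K * ?G s) = ereal (\<beta> * K) * \<rho> ?G" by (rule \<rho>_scale[OF GLp \<beta>K])
  also have "\<dots> \<le> ereal (\<beta> * K) * ereal (\<alpha> * g x)"
    using g xa \<beta>K by (intro ereal_mult_left_mono) (auto simp: weight_def)
  finally show ?thesis by (simp add: stage_risk_payoff add_left_mono mult.assoc mult.left_commute)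
qed

lemma stage_risk_zero: "stage_risk m \<rho> (\<lambda>_. 0) x a = \<rho> (\<lambda>w. cost m x a (T x a w))"
  by (simp add: stage_risk_def Let_def)

lemmas between_zero = regular_between[OF regular_zero]

text \<open>Compare the zero function with \<open>v\<close>: from 0 \<le> v - l the contraction
  gives (1 - \<gamma>) l \<le> stage risk - \<gamma> l, and the terms in l combine. The bound is
  kept general because it is used for \<open>bl\<close> and later for its increasing
  majorant.\<close>

lemma stage_risk_lower:
  assumes v: "between v" and l: "weight (\<lambda>x. - l x)" "\<And>x. ereal (l x) \<le> v x"
    and xa: "(x, a) \<in> adm m" and c: "ereal ((1 - \<gamma>) * l x) \<le> \<rho> (\<lambda>w. cost m x a (T x a w))"
  shows "ereal (l x) \<le> stage_risk m \<rho> v x a"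
proof -
  have "0 \<le> v x + ereal (1 * - l x)" for x
    using l(2)[of x] by (cases "v x") auto
  from stage_risk_contraction[OF l(1) between_zero v zero_le_one this xa] c
  have "ereal ((1 - \<gamma>) * l x) \<le> stage_risk m \<rho> v x a + ereal (\<gamma> * 1 * - l x)"
    by (simp add: stage_risk_zero)
  then show ?thesis by (cases "stage_risk m \<rho> v x a") (auto simp: algebra_simps)
qed

lemma stage_risk_bounds:
  assumes v: "between v" and xa: "(x, a) \<in> adm m"
  shows "ereal (bl x) \<le> stage_risk m \<rho> v x a" "stage_risk m \<rho> v x a \<le> ereal (bu x)"
proof -
  show "ereal (bl x) \<le> stage_risk m \<rho> v x a"
    using v cost_bounds[OF xa] by (intro stage_risk_lower weight_neg_bl xa) (auto simp: between_def)
  have "v x \<le> 0 + ereal (1 * bu x)" for x using v by (simp add: between_def)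
  from stage_risk_contraction[OF weight_bu v between_zero zero_le_one this xa]
  have "stage_risk m \<rho> v x a \<le> \<rho> (\<lambda>w. cost m x a (T x a w)) + ereal (\<gamma> * 1 * bu x)"
    by (simp add: stage_risk_zero)
  also have "\<dots> \<le> ereal ((1 - \<gamma>) * bu x) + ereal (\<gamma> * 1 * bu x)"
    using cost_bounds[OF xa] by (intro add_right_mono) simp
  finally show "stage_risk m \<rho> v x a \<le> ereal (bu x)" by (simp add: algebra_simps)
qed

lemma bellman_op_contraction:
  assumes g: "weight g" and v: "between v" and w: "between w" and K: "0 \<le> K"
    and le: "\<And>x. v x \<le> w x + ereal (K * g x)"
  shows "bellman_op m \<rho> v x \<le> bellman_op m \<rho> w x + ereal (\<gamma> * K * g x)"
proof -
  \<comment> \<open>With the finite error moved to the left, the right-hand side is a bare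
    infimum.\<close>
  have "bellman_op m \<rho> v x - ereal (\<gamma> * K * g x) \<le> bellman_op m \<rho> w x"
    unfolding bellman_op_def[of m \<rho> w]
  proof (rule INF_greatest)
    fix a assume "a \<in> adm_at m x"
    then have xa: "(x, a) \<in> adm m" by simp
    have "bellman_op m \<rho> v x \<le> stage_risk m \<rho> w x a + ereal (\<gamma> * K * g x)"
      using bellman_op_le[OF xa] stage_risk_contraction[OF g v w K le xa] by (rule order_trans)
    then show "bellman_op m \<rho> v x - ereal (\<gamma> * K * g x) \<le> stage_risk m \<rho> w x a"
      by (simp add: ereal_minus_le_iff add.commute)
  qed
  then show ?thesis by (simp add: ereal_minus_le_iff add.commute)
qed

lemma bellman_op_bounds:
  assumes v: "between v"
  shows "ereal (bl x) \<le> bellman_op m \<rho> v x" "bellman_op m \<rho> v x \<le> ereal (bu x)"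
proof -
  show "ereal (bl x) \<le> bellman_op m \<rho> v x"
    unfolding bellman_op_def using stage_risk_bounds[OF v] by (intro INF_greatest) simp
  obtain a where "(x, a) \<in> adm m" using adm_at_nonempty[of x] by auto
  then show "bellman_op m \<rho> v x \<le> ereal (bu x)"
    using bellman_op_le stage_risk_bounds(2)[OF v] order_trans by blast
qed

lemma bellman_op_regular: "regular v \<Longrightarrow> regular (bellman_op m \<rho> v)"
  using bellman_op_lsc bellman_op_mono bellman_op_bounds[OF regular_between]
  by (simp add: regular_def lsc_incr_between_def)

lemma bellman_op_pow_regular: "regular v \<Longrightarrow> regular ((bellman_op m \<rho> ^^ n) v)"
  by (induction n) (auto intro: bellman_op_regular)

lemma bellman_op_pow_contraction:
  assumes g: "weight g" and v: "regular v" and w: "regular w"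
    and le: "\<And>x. v x \<le> w x + ereal (g x)"
  shows "(bellman_op m \<rho> ^^ n) v x \<le> (bellman_op m \<rho> ^^ n) w x + ereal (\<gamma> ^ n * g x)"
proof (induction n arbitrary: x)
  case (Suc n)
  from bellman_op_contraction[OF g _ _ _ Suc.IH, of x]
  show ?case
    using bellman_op_pow_regular[OF v] bellman_op_pow_regular[OF w] \<gamma>(1)
    by (simp add: regular_between mult.assoc)
qed (use le in simp)

text \<open>Here the index counts stages; these iterates turn out to be the values
  \<open>J_fin\<close>.\<close>

definition W :: "nat \<Rightarrow> real \<Rightarrow> ereal" where
  "W n = (bellman_op m \<rho> ^^ n) (\<lambda>_. 0)"

lemma W_0: "W 0 = (\<lambda>_. 0)" and W_Suc: "W (Suc n) = bellman_op m \<rho> (W n)"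
  by (simp_all add: W_def)

lemma W_add: "W (n + k) = (bellman_op m \<rho> ^^ n) (W k)"
  by (simp add: W_def funpow_add)

lemma W_regular: "regular (W n)"
  unfolding W_def by (rule bellman_op_pow_regular[OF regular_zero])

lemma between_width:
  assumes "between v" "between w"
  shows "v x \<le> w x + ereal (bu x - bl x)"
proof -
  have "real_of_ereal (v x) \<le> real_of_ereal (w x) + (bu x - bl x)"
    using between_real(3)[OF assms(1), of x] between_real(2)[OF assms(2), of x] by linarith
  then show ?thesis
    using between_real(1)[OF assms(1), of x] between_real(1)[OF assms(2), of x]
    by (metis ereal_less_eq(3) plus_ereal.simps(1))
qed

lemma bellman_op_pow_close:
  assumes "regular v" "regular w"
  shows "(bellman_op m \<rho> ^^ n) v x \<le> (bellman_op m \<rho> ^^ n) w x + ereal (\<gamma> ^ n * (bu x - bl x))"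
  using assms by (intro bellman_op_pow_contraction[OF weight_width] between_width regular_between)

lemma between_finite: "between v \<Longrightarrow> \<bar>v x\<bar> \<noteq> \<infinity>"
  by (subst between_real(1)) simp_all

text \<open>\<open>W (n + k)\<close> and \<open>W n\<close> are the same n-fold iterate, started at
  \<open>W k\<close> and at 0. Both starting points lie in the band, so n contractions leave a
  distance of at most \<gamma> ^ n times its width.\<close>

lemma W_limit:
  obtains L where "\<And>n. W n x \<le> ereal L + ereal (\<gamma> ^ n * (bu x - bl x))"
    "\<And>n. ereal L \<le> W n x + ereal (\<gamma> ^ n * (bu x - bl x))" "(\<lambda>n. W n x) \<longlonglongrightarrow> ereal L"
proof (rule ereal_geometric_Cauchy_limit[OF \<gamma>])
  show "\<bar>W n x\<bar> \<noteq> \<infinity>" for n using between_finite[OF regular_between[OF W_regular]] .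
  show "W (n + k) x \<le> W n x + ereal (\<gamma> ^ n * (bu x - bl x))" for n k
    unfolding W_add W_def[of n] by (intro bellman_op_pow_close W_regular regular_zero)
  show "W n x \<le> W (n + k) x + ereal (\<gamma> ^ n * (bu x - bl x))" for n k
    unfolding W_add W_def[of n] by (intro bellman_op_pow_close W_regular regular_zero)
qed (rule that)

lemma markov_policy_admissible: "d \<in> markov_policies m \<infinity> \<Longrightarrow> (x, d n x) \<in> adm m"
  by (auto simp: markov_policies_def markov_rules_def)

lemma J_pol_between:
  assumes "d \<in> markov_policies m \<infinity>"
  shows "between (J_pol m \<rho> d n)"
  using assms
proof (induction n arbitrary: d)
  case 0
  then show ?case using between_zero by (simp add: J_pol_0)
next
  case (Suc n)
  show ?case
    using stage_risk_bounds[OF Suc.IH[OF markov_policies_shift[OF Suc.prems]]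
        markov_policy_admissible[OF Suc.prems, of _ 0]]
      J_pol_measurable[OF Suc.prems, of "Suc n"]
    by (simp add: between_def J_pol_Suc rule_op_def[abs_def])
qed

lemma W_le_J_pol:
  assumes "d \<in> markov_policies m \<infinity>"
  shows "W n x \<le> J_pol m \<rho> d n x"
  using assms
proof (induction n arbitrary: d x)
  case (Suc n)
  note shift = markov_policies_shift[OF Suc.prems]
  have "W (Suc n) x \<le> stage_risk m \<rho> (W n) x (d 0 x)"
    unfolding W_Suc by (rule bellman_op_le[OF markov_policy_admissible[OF Suc.prems]])
  also have "\<dots> \<le> J_pol m \<rho> d (Suc n) x"
    unfolding J_pol_Suc rule_op_def
    by (rule stage_risk_mono[OF regular_between[OF W_regular] J_pol_between[OF shift]
          Suc.IH[OF shift] markov_policy_admissible[OF Suc.prems]])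
  finally show ?case .
qed (simp add: W_0 J_pol_0)

text \<open>A minimizer of \<open>W n\<close> is put in front of an optimal n-stage policy. The
  resulting policy depends on n and is in general not stationary.\<close>

lemma J_pol_attains_W: "\<exists>d\<in>markov_policies m \<infinity>. J_pol m \<rho> d n = W n"
proof (induction n)
  case 0
  obtain d where "d \<in> markov_rules m" using minimizer_exists[OF regular_zero] by blast
  then show ?case by (intro bexI[of _ "\<lambda>_. d"]) (auto simp: J_pol_0 W_0 markov_policies_def)
next
  case (Suc n)
  then obtain d where d: "d \<in> markov_policies m \<infinity>" "J_pol m \<rho> d n = W n" by blast
  obtain e where e: "e \<in> markov_rules m" "rule_op m \<rho> e (W n) = bellman_op m \<rho> (W n)"
    using minimizer_exists[OF W_regular] by blast
  have "case_nat e d \<in> markov_policies m \<infinity>"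
    using d(1) e(1) by (auto simp: markov_policies_def split: nat.split)
  moreover have "J_pol m \<rho> (case_nat e d) (Suc n) = W (Suc n)"
    by (simp add: J_pol_Suc d(2) e(2) W_Suc)
  ultimately show ?case by blast
qed

lemma J_fin_eq: "J_fin m \<rho> n = W n"
proof (rule ext, rule antisym)
  fix x
  obtain d where "d \<in> markov_policies m \<infinity>" "J_pol m \<rho> d n = W n"
    using J_pol_attains_W by blast
  then show "J_fin m \<rho> n x \<le> W n x" unfolding J_fin_def by (intro INF_lower2[of d]) auto
  show "W n x \<le> J_fin m \<rho> n x" unfolding J_fin_def by (intro INF_greatest W_le_J_pol)
qed

text \<open>The two values apply the same first n rules and differ only in what they are applied to:
  a k-stage value or 0, both within the band.\<close>

lemma J_pol_close:
  assumes "d \<in> markov_policies m \<infinity>"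
  shows "J_pol m \<rho> d (n + k) x \<le> J_pol m \<rho> d n x + ereal (\<gamma> ^ n * (bu x - bl x))"
    and "J_pol m \<rho> d n x \<le> J_pol m \<rho> d (n + k) x + ereal (\<gamma> ^ n * (bu x - bl x))"
proof -
  have "J_pol m \<rho> d (n + k) x \<le> J_pol m \<rho> d n x + ereal (\<gamma> ^ n * (bu x - bl x)) \<and>
    J_pol m \<rho> d n x \<le> J_pol m \<rho> d (n + k) x + ereal (\<gamma> ^ n * (bu x - bl x))"
    using assms
  proof (induction n arbitrary: d x)
    case 0
    then show ?case
      using between_width[OF J_pol_between[OF 0] J_pol_between[OF 0]] by simp
  next
    case (Suc n)
    note shift = markov_policies_shift[OF Suc.prems]
    show ?case
      using Suc.IH[OF shift] stage_risk_contraction[OF weight_width J_pol_between[OF shift]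
          J_pol_between[OF shift] zero_le_power[OF \<gamma>(1)] _ markov_policy_admissible[OF Suc.prems]]
      by (simp add: J_pol_Suc rule_op_def)
  qed
  then show "J_pol m \<rho> d (n + k) x \<le> J_pol m \<rho> d n x + ereal (\<gamma> ^ n * (bu x - bl x))"
    and "J_pol m \<rho> d n x \<le> J_pol m \<rho> d (n + k) x + ereal (\<gamma> ^ n * (bu x - bl x))" by auto
qed

lemma J_pol_tendsto:
  assumes d: "d \<in> markov_policies m \<infinity>"
  shows "(\<lambda>n. J_pol m \<rho> d n x) \<longlonglongrightarrow> J_inf_pol m \<rho> d x"
proof -
  obtain L where "(\<lambda>n. J_pol m \<rho> d n x) \<longlonglongrightarrow> ereal L"
    by (rule ereal_geometric_Cauchy_limit[of \<gamma> "\<lambda>n. J_pol m \<rho> d n x" "bu x - bl x",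
        OF \<gamma> between_finite[OF J_pol_between[OF d]] J_pol_close[OF d]], rule that)
  then show ?thesis by (simp add: J_inf_pol_def limI)
qed

lemma W_tendsto: "(\<lambda>n. W n x) \<longlonglongrightarrow> J_lim m \<rho> x"
proof -
  obtain L where "(\<lambda>n. W n x) \<longlonglongrightarrow> ereal L" by (rule W_limit[of x], rule that)
  then show ?thesis by (simp add: J_lim_def J_fin_eq limI)
qed

lemma J_lim_close:
  shows "W n x \<le> J_lim m \<rho> x + ereal (\<gamma> ^ n * (bu x - bl x))"
    and "J_lim m \<rho> x \<le> W n x + ereal (\<gamma> ^ n * (bu x - bl x))"
proof -
  obtain L where L: "\<And>n. W n x \<le> ereal L + ereal (\<gamma> ^ n * (bu x - bl x))"
    "\<And>n. ereal L \<le> W n x + ereal (\<gamma> ^ n * (bu x - bl x))" "(\<lambda>n. W n x) \<longlonglongrightarrow> ereal L"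
    by (rule W_limit[of x], rule that)
  have "J_lim m \<rho> x = ereal L" using LIMSEQ_unique[OF W_tendsto L(3)] .
  with L show "W n x \<le> J_lim m \<rho> x + ereal (\<gamma> ^ n * (bu x - bl x))"
    and "J_lim m \<rho> x \<le> W n x + ereal (\<gamma> ^ n * (bu x - bl x))" by auto
qed

end

section \<open>Regularity and optimality of the limit value function\<close>

lemma lsc_on_realI:
  assumes "\<And>u x e. u \<longlonglongrightarrow> x \<Longrightarrow> 0 < e \<Longrightarrow> \<forall>\<^sub>F k in sequentially. f x - e < f (u k)"
  shows "lsc_on UNIV (\<lambda>x. ereal (f x))"
  unfolding lsc_on_def le_Liminf_iff
proof (intro ballI allI impI)
  fix x u y assume u: "u \<longlonglongrightarrow> x" and y: "y < ereal (f x)"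
  show "\<forall>\<^sub>F k in sequentially. y < ereal (f (u k))"
  proof (cases y)
    case (real r)
    then have "0 < f x - r" using y by simp
    from assms[OF u this] show ?thesis using real by simp
  qed (use y in auto)
qed

context discounted_mdp
begin

text \<open>The least increasing majorant of \<open>bl\<close>. The real supremum is meaningful
  because \<open>bl\<close> is nonpositive, and monotonicity makes it Borel.\<close>

definition blm :: "real \<Rightarrow> real" where
  "blm x = (SUP y\<in>{..x}. bl y)"

lemma bdd_above_bl: "bdd_above (bl ` A)"
  using bl_nonpos by (intro bdd_aboveI[of _ 0]) auto

lemma bl_le_blm: "y \<le> x \<Longrightarrow> bl y \<le> blm x"
  unfolding blm_def by (intro cSUP_upper bdd_above_bl) simp

lemma blm_nonpos: "blm x \<le> 0"
  unfolding blm_def using bl_nonpos by (intro cSUP_least) auto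

lemma blm_mono: "mono blm"
  unfolding blm_def by (intro monoI cSUP_subset_mono bdd_above_bl) auto

text \<open>For y \<le> x the action is also admissible at y and leads to a smaller state, so
  bl(T(y,a)) \<le> blm(T(x,a)). The growth condition at y then bounds the risk by - \<alpha> bl(y),
  and the supremum over y \<le> x remains to be taken; passing to the negated risk puts it on the
  smaller side.\<close>

lemma blm_growth:
  assumes xa: "(x, a) \<in> adm m"
  shows "\<rho> (\<lambda>w. - blm (T x a w)) \<le> ereal (\<alpha> * - blm x)"
proof -
  let ?R = "\<rho> (\<lambda>w. - blm (T x a w))"
  have meas: "blm \<in> borel_measurable borel" by (rule borel_measurable_mono[OF blm_mono])
  have "\<bar>- blm y\<bar> \<le> bu y - bl y" for y
    using bl_le_blm[of y y] blm_nonpos[of y] bu_nonneg[of y] by simp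
  then have Lp: "(\<lambda>w. - blm (T x a w)) \<in> Lp M p"
    using meas xa by (intro state_Lp) auto
  have "ereal (\<alpha> * bl y) \<le> - ?R" if "y \<in> {..x}" for y
  proof -
    have ya: "(y, a) \<in> adm m" using adm_mono[OF _ xa] that by simp
    have "?R \<le> \<rho> (\<lambda>w. - bl (T y a w))"
    proof (rule \<rho>_mono[OF Lp weight_Lp[OF weight_neg_bl ya]])
      fix w assume "w \<in> space M"
      then have "T y a w \<le> T x a w" using T_mono[OF _ xa] that by simp
      then show "- blm (T x a w) \<le> - bl (T y a w)" using bl_le_blm by simp
    qed
    also have "\<dots> \<le> ereal (\<alpha> * - bl y)" by (rule growth_lower[OF ya])
    finally show ?thesis by (cases ?R) auto
  qed
  then have "ereal (\<alpha> * (SUP y\<in>{..x}. bl y)) \<le> - ?R"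
    using \<alpha> by (intro mult_SUP_le_ereal) auto
  then show ?thesis by (cases ?R) (auto simp: blm_def)
qed

lemma weight_neg_blm: "weight (\<lambda>x. - blm x)"
proof -
  have "0 \<le> - blm x \<and> - blm x \<le> bu x - bl x" for x
    using bl_le_blm[of x x] blm_nonpos[of x] bu_nonneg[of x] by simp
  then show ?thesis
    using borel_measurable_mono[OF blm_mono] blm_growth by (auto simp: weight_def)
qed

text \<open>The risk of the cost is the stage risk of the zero function and hence increasing in the
  state, so the lower bounds at all y \<le> x apply at x.\<close>

lemma blm_cost:
  assumes xa: "(x, a) \<in> adm m"
  shows "ereal ((1 - \<gamma>) * blm x) \<le> \<rho> (\<lambda>w. cost m x a (T x a w))"
  unfolding blm_def
proof (rule mult_SUP_le_ereal)
  fix y assume "y \<in> {..x}"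
  then have ya: "(y, a) \<in> adm m" and le: "y \<le> x" using adm_mono[OF _ xa] by auto
  have "ereal ((1 - \<gamma>) * bl y) \<le> \<rho> (\<lambda>w. cost m y a (T y a w))" using cost_bounds[OF ya] by simp
  also have "\<dots> \<le> \<rho> (\<lambda>w. cost m x a (T x a w))"
    using stage_risk_incr[OF regular_zero le xa] by (simp add: stage_risk_zero)
  finally show "ereal ((1 - \<gamma>) * bl y) \<le> \<rho> (\<lambda>w. cost m x a (T x a w))" .
qed (use \<gamma> in auto)

lemma blm_le_W: "ereal (blm x) \<le> W n x"
proof (induction n arbitrary: x)
  case 0
  then show ?case using blm_nonpos[of x] by (simp add: W_0)
next
  case (Suc n)
  show ?case
    unfolding W_Suc bellman_op_def
    using stage_risk_lower[OF regular_between[OF W_regular] weight_neg_blm Suc.IH _ blm_cost]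
    by (intro INF_greatest) simp
qed

lemma J_lim_between_bounds: "ereal (bl x) \<le> J_lim m \<rho> x" "J_lim m \<rho> x \<le> ereal (bu x)"
proof -
  have "\<forall>n\<ge>0. ereal (bl x) \<le> W n x" "\<forall>n\<ge>0. W n x \<le> ereal (bu x)"
    using regular_between[OF W_regular] by (auto simp: between_def)
  then show "ereal (bl x) \<le> J_lim m \<rho> x" "J_lim m \<rho> x \<le> ereal (bu x)"
    using LIMSEQ_le_const[OF W_tendsto] LIMSEQ_le_const2[OF W_tendsto] by blast+
qed

text \<open>Start from 0 \<le> W k - blm, iterate n times with the weight - blm, and let k tend to
  infinity. The error is now controlled by a decreasing function, hence uniformly to the right of
  any point.\<close>

lemma W_le_J_lim: "W n x \<le> J_lim m \<rho> x + ereal (\<gamma> ^ n * - blm x)"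
proof (rule Lim_bounded2)
  show "(\<lambda>k. W (k + n) x + ereal (\<gamma> ^ n * - blm x)) \<longlonglongrightarrow> J_lim m \<rho> x + ereal (\<gamma> ^ n * - blm x)"
  proof (rule tendsto_add_ereal)
    show "\<bar>J_lim m \<rho> x\<bar> \<noteq> \<infinity>"
      using J_lim_between_bounds[of x] by (cases "J_lim m \<rho> x") auto
    show "(\<lambda>k. W (k + n) x) \<longlonglongrightarrow> J_lim m \<rho> x"
      by (rule LIMSEQ_ignore_initial_segment[OF W_tendsto])
  qed simp_all
  have "0 \<le> W k x + ereal (- blm x)" for k x
    using blm_le_W[of x k] by (cases "W k x") auto
  then have "W n x \<le> W (n + k) x + ereal (\<gamma> ^ n * - blm x)" for k
    unfolding W_add W_def[of n]
    by (intro bellman_op_pow_contraction weight_neg_blm W_regular regular_zero)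
  then show "\<forall>k\<ge>0. W n x \<le> W (k + n) x + ereal (\<gamma> ^ n * - blm x)"
    by (simp add: add.commute)
qed

lemma J_lim_mono: "mono (J_lim m \<rho>)"
proof (rule monoI)
  fix x y :: real assume "x \<le> y"
  then have "W n x \<le> W n y" for n
    using W_regular[of n] by (auto simp: regular_def lsc_incr_between_def dest: monoD)
  then show "J_lim m \<rho> x \<le> J_lim m \<rho> y" by (intro LIMSEQ_le[OF W_tendsto W_tendsto]) blast
qed

lemma J_lim_regular: "regular (J_lim m \<rho>)"
proof -
  define j where "j x = real_of_ereal (J_lim m \<rho> x)" for x
  define wr where "wr n x = real_of_ereal (W n x)" for n x
  have J: "J_lim m \<rho> x = ereal (j x)" for x
    using J_lim_between_bounds[of x] unfolding j_def by (cases "J_lim m \<rho> x") auto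
  have W: "W n x = ereal (wr n x)" for n x
    unfolding wr_def by (rule between_real(1)[OF regular_between[OF W_regular]])
  have "lsc_on UNIV (\<lambda>x. ereal (j x))"
  proof (rule lsc_on_realI)
    fix u :: "nat \<Rightarrow> real" and x e :: real assume u: "u \<longlonglongrightarrow> x" and e: "0 < e"
    \<comment> \<open>Eventually u k > x - 1, and there - blm is at most its value at x - 1. One n
      thus serves the whole tail; the three thirds of e pay for this error, for the limit at x, and
      for the lower semicontinuity of \<open>W n\<close>.\<close>
    have "(\<lambda>n. \<gamma> ^ n * - blm (x - 1)) \<longlonglongrightarrow> 0"
      using tendsto_mult_right[OF LIMSEQ_realpow_zero[OF \<gamma>], of "- blm (x - 1)"] by simp
    moreover have "(\<lambda>n. wr n x) \<longlonglongrightarrow> j x" using W_tendsto[of x] unfolding J W by simp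
    ultimately have "\<forall>\<^sub>F n in sequentially. \<gamma> ^ n * - blm (x - 1) < e / 3 \<and> j x - e / 3 < wr n x"
      using e by (intro eventually_conj order_tendstoD) auto
    then obtain n where n: "\<gamma> ^ n * - blm (x - 1) < e / 3" "j x - e / 3 < wr n x"
      by (auto dest: eventually_happens)
    have "\<forall>\<^sub>F k in sequentially. wr n x - e / 3 < wr n (u k)"
      using lsc_on_real_eventually[OF regular_real(1)[OF W_regular], of x u "e/3" n] u e
      by (simp add: wr_def)
    moreover have "\<forall>\<^sub>F k in sequentially. x - 1 < u k"
      using u by (rule order_tendstoD) simp
    ultimately show "\<forall>\<^sub>F k in sequentially. j x - e < j (u k)"
    proof eventually_elim
      case (elim k)
      have "wr n (u k) \<le> j (u k) + \<gamma> ^ n * - blm (u k)"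
        using W_le_J_lim[of n "u k"] unfolding J W by simp
      moreover have "\<gamma> ^ n * - blm (u k) \<le> \<gamma> ^ n * - blm (x - 1)"
        using monoD[OF blm_mono, of "x - 1" "u k"] elim(2) \<gamma>(1) by (intro mult_left_mono) auto
      ultimately show ?case using elim(1) n by linarith
    qed
  qed
  moreover have "J_lim m \<rho> = (\<lambda>x. ereal (j x))" using J by blast
  ultimately show ?thesis
    using J_lim_mono J_lim_between_bounds by (simp add: regular_def lsc_incr_between_def)
qed

lemma J_lim_real: "J_lim m \<rho> x = ereal (real_of_ereal (J_lim m \<rho> x))"
  by (rule between_real(1)[OF regular_between[OF J_lim_regular]])

text \<open>A fixed point is its own n-fold iterate, so it has geometrically small distance to the
  iterates of 0.\<close>

lemma fixed_point_unique:
  assumes v: "regular v" and fp: "bellman_op m \<rho> v = v"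
  shows "v = J_lim m \<rho>"
proof
  fix x
  have pow: "(bellman_op m \<rho> ^^ n) v = v" for n by (induction n) (simp_all add: fp)
  have vx: "v x = ereal (real_of_ereal (v x))" by (rule between_real(1)[OF regular_between[OF v]])
  have "(\<lambda>n. W n x) \<longlonglongrightarrow> ereal (real_of_ereal (v x))"
    using bellman_op_pow_close[OF regular_zero v, of _ x] bellman_op_pow_close[OF v regular_zero, of _ x]
    by (intro ereal_tendsto_geometric[OF \<gamma>, where c = "bu x - bl x"])
      (simp_all add: W_def pow flip: vx)
  then show "v x = J_lim m \<rho> x" using LIMSEQ_unique W_tendsto vx by metis
qed

text \<open>The iterates \<open>W (Suc n)\<close> converge to \<open>J_lim\<close>, but by one more
  contraction also to its Bellman image.\<close>

lemma J_lim_fixed_point: "bellman_op m \<rho> (J_lim m \<rho>) = J_lim m \<rho>"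
proof
  fix x
  let ?B = "bellman_op m \<rho> (J_lim m \<rho>)"
  have Bx: "?B x = ereal (real_of_ereal (?B x))"
    by (rule between_real(1)[OF regular_between[OF bellman_op_regular[OF J_lim_regular]]])
  note bw = regular_between[OF W_regular] and bj = regular_between[OF J_lim_regular]
  have "(\<lambda>n. W (Suc n) x) \<longlonglongrightarrow> ereal (real_of_ereal (?B x))"
  proof (rule ereal_tendsto_geometric[OF \<gamma>, where c = "\<gamma> * (bu x - bl x)"])
    show "W (Suc n) x \<le> ereal (real_of_ereal (?B x)) + ereal (\<gamma> ^ n * (\<gamma> * (bu x - bl x)))" for n
      using bellman_op_contraction[OF weight_width bw bj zero_le_power[OF \<gamma>(1)] J_lim_close(1)[of n], of x]
      by (simp add: W_Suc mult_ac flip: Bx)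
    show "ereal (real_of_ereal (?B x)) \<le> W (Suc n) x + ereal (\<gamma> ^ n * (\<gamma> * (bu x - bl x)))" for n
      using bellman_op_contraction[OF weight_width bj bw zero_le_power[OF \<gamma>(1)] J_lim_close(2)[of _ n], of x]
      by (simp add: W_Suc mult_ac flip: Bx)
  qed
  then show "?B x = J_lim m \<rho> x"
    using LIMSEQ_unique[OF LIMSEQ_Suc[OF W_tendsto]] Bx by metis
qed

text \<open>\<open>J_lim\<close> is also a fixed point of the operator of the rule d, and repeated
  application of that operator to 0 approaches this fixed point geometrically.\<close>

lemma J_inf_pol_stationary:
  assumes d: "d \<in> markov_rules m" and fp: "rule_op m \<rho> d (J_lim m \<rho>) = bellman_op m \<rho> (J_lim m \<rho>)"
  shows "J_inf_pol m \<rho> (\<lambda>_. d) = J_lim m \<rho>"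
proof
  fix x
  have mp: "(\<lambda>_. d) \<in> markov_policies m \<infinity>" using d by (simp add: markov_policies_def)
  note bp = J_pol_between[OF mp] and bj = regular_between[OF J_lim_regular]
  have close: "J_pol m \<rho> (\<lambda>_. d) n x \<le> J_lim m \<rho> x + ereal (\<gamma> ^ n * (bu x - bl x)) \<and>
    J_lim m \<rho> x \<le> J_pol m \<rho> (\<lambda>_. d) n x + ereal (\<gamma> ^ n * (bu x - bl x))" for n x
  proof (induction n arbitrary: x)
    case 0
    then show ?case using between_width[OF bp bj] between_width[OF bj bp] by simp
  next
    case (Suc n)
    have J: "J_lim m \<rho> x = stage_risk m \<rho> (J_lim m \<rho>) x (d x)"
      using fp J_lim_fixed_point by (metis rule_op_def)
    show ?case
      using stage_risk_contraction[OF weight_width bp bj zero_le_power[OF \<gamma>(1), of n] _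
          markov_policy_admissible[OF mp, of x]]
        stage_risk_contraction[OF weight_width bj bp zero_le_power[OF \<gamma>(1), of n] _
          markov_policy_admissible[OF mp, of x]] Suc.IH
      by (simp add: J_pol_Suc rule_op_def flip: J)
  qed
  have "(\<lambda>n. J_pol m \<rho> (\<lambda>_. d) n x) \<longlonglongrightarrow> ereal (real_of_ereal (J_lim m \<rho> x))"
    using close[of _ x] by (intro ereal_tendsto_geometric[OF \<gamma>]) (auto simp flip: J_lim_real)
  then show "J_inf_pol m \<rho> (\<lambda>_. d) x = J_lim m \<rho> x"
    using LIMSEQ_unique[OF J_pol_tendsto[OF mp]] J_lim_real by metis
qed

text \<open>A stationary minimizer attains the limit; conversely the bound of n-stage policy values
  by \<open>W n\<close> survives the passage to the limit.\<close>

lemma J_inf_eq: "J_inf m \<rho> = J_lim m \<rho>"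
proof (rule ext, rule antisym)
  fix x
  obtain d where d: "d \<in> markov_rules m" "rule_op m \<rho> d (J_lim m \<rho>) = bellman_op m \<rho> (J_lim m \<rho>)"
    by (rule minimizer_exists[OF J_lim_regular], rule that)
  then have "(\<lambda>_. d) \<in> markov_policies m \<infinity>" by (simp add: markov_policies_def)
  then show "J_inf m \<rho> x \<le> J_lim m \<rho> x"
    unfolding J_inf_def using J_inf_pol_stationary[OF d] by (intro INF_lower2[of "\<lambda>_. d"]) auto
  show "J_lim m \<rho> x \<le> J_inf m \<rho> x"
    unfolding J_inf_def
  proof (rule INF_greatest)
    fix d assume d: "d \<in> markov_policies m \<infinity>"
    show "J_lim m \<rho> x \<le> J_inf_pol m \<rho> d x"
      by (rule LIMSEQ_le[OF W_tendsto J_pol_tendsto[OF d]]) (use W_le_J_pol[OF d] in blast)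
  qed
qed

end

section \<open>Rescaling the bounds, and application to both horizons\<close>

lemma bounding_pair_scale:
  assumes "bounding_pair bl bu" "1 \<le> c"
  shows "bounding_pair (\<lambda>x. c * bl x) (\<lambda>x. c * bu x)"
proof -
  obtain el eu where e: "0 \<le> el" "0 \<le> eu" "el + eu = 1" "\<And>x. bl x \<le> - el \<and> eu \<le> bu x"
    and [measurable]: "bl \<in> borel_measurable borel" "bu \<in> borel_measurable borel"
    using assms(1) unfolding bounding_pair_def by blast
  have "c * bl x \<le> - el \<and> eu \<le> c * bu x" for x
  proof -
    \<comment> \<open>A factor at least 1 moves both bounds away from zero, so the same two
      constants remain valid.\<close>
    have "bl x \<le> 0" "0 \<le> bu x" using e(1,2) e(4)[of x] by linarith+
    then have "c * bl x \<le> 1 * bl x" "1 * bu x \<le> c * bu x"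
      using assms(2) by (blast intro: mult_right_mono mult_right_mono_neg)+
    then show ?thesis using e(4)[of x] by linarith
  qed
  then show ?thesis using e(1-3) by (auto simp: bounding_pair_def)
qed

lemma locally_dominated_scale:
  assumes "locally_dominated m p b" "0 \<le> c"
  shows "locally_dominated m p (\<lambda>x. c * b x)"
  unfolding locally_dominated_def
proof
  fix xa assume "xa \<in> adm m"
  with assms(1) obtain e \<Theta>1 \<Theta>2 where *: "0 < e" "\<Theta>1 \<in> borel_measurable (noise m)"
    "\<Theta>2 \<in> borel_measurable (noise m)" "\<forall>z\<in>space (noise m). 0 \<le> \<Theta>1 z \<and> 0 \<le> \<Theta>2 z"
    "(\<lambda>w. \<Theta>1 (rep m w)) \<in> Lp (prob m) p" "(\<lambda>w. \<Theta>2 (rep m w)) \<in> Lp (prob m) p"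
    "\<forall>z\<in>space (noise m). \<forall>(x, a)\<in>adm m \<inter> cball xa e.
       \<bar>cost m x a (trans m x a z)\<bar> \<le> \<Theta>1 z \<and> b (trans m x a z) \<le> \<Theta>2 z"
    unfolding locally_dominated_def by blast
  have meas: "(\<lambda>z. c * \<Theta>2 z) \<in> borel_measurable (noise m)" using *(3) by measurable
  have nonneg: "\<forall>z\<in>space (noise m). 0 \<le> \<Theta>1 z \<and> 0 \<le> c * \<Theta>2 z" using *(4) assms(2) by simp
  have Lp: "(\<lambda>w. c * \<Theta>2 (rep m w)) \<in> Lp (prob m) p" using *(6) by (rule Lp_scale)
  have dom: "\<forall>z\<in>space (noise m). \<forall>(x, a)\<in>adm m \<inter> cball xa e.
      \<bar>cost m x a (trans m x a z)\<bar> \<le> \<Theta>1 z \<and> c * b (trans m x a z) \<le> c * \<Theta>2 z"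
  proof (intro ballI)
    fix z q assume "z \<in> space (noise m)" "q \<in> adm m \<inter> cball xa e"
    with *(7) have "case q of (x, a) \<Rightarrow>
        \<bar>cost m x a (trans m x a z)\<bar> \<le> \<Theta>1 z \<and> b (trans m x a z) \<le> \<Theta>2 z" by blast
    then show "case q of (x, a) \<Rightarrow>
        \<bar>cost m x a (trans m x a z)\<bar> \<le> \<Theta>1 z \<and> c * b (trans m x a z) \<le> c * \<Theta>2 z"
      using assms(2) by (auto simp: mult_left_mono split: prod.splits)
  qed
  show "\<exists>e>0. \<exists>\<Theta>1\<in>borel_measurable (noise m). \<exists>\<Theta>2\<in>borel_measurable (noise m).
        (\<forall>z\<in>space (noise m). 0 \<le> \<Theta>1 z \<and> 0 \<le> \<Theta>2 z) \<and>
        (\<lambda>w. \<Theta>1 (rep m w)) \<in> Lp (prob m) p \<and> (\<lambda>w. \<Theta>2 (rep m w)) \<in> Lp (prob m) p \<and>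
        (\<forall>z\<in>space (noise m). \<forall>(x, a)\<in>adm m \<inter> cball xa e.
           \<bar>cost m x a (trans m x a z)\<bar> \<le> \<Theta>1 z \<and> c * b (trans m x a z) \<le> \<Theta>2 z)"
    by (rule exI[of _ e], rule conjI[OF *(1)], rule bexI[OF _ *(2)], rule bexI[OF _ meas],
        intro conjI nonneg *(5) Lp dom)
qed

theorem proposition7p2:
  fixes m :: "('w, 'z, 'a::polish_space) decision_model"
    and p :: real
    and \<rho> :: "'w risk_measure"
  assumes p: "1 \<le> p"
    and model: "stationary_model m"
    and M2_compact: "\<And>x. compact (adm_at m x)"
    and M2_usc: "usc_correspondence (adm_at m)"
    and M2_decreasing: "\<And>x y. x \<le> y \<Longrightarrow> adm_at m y \<subseteq> adm_at m x"
    and M3_lsc: "\<And>z. z \<in> space (noise m) \<Longrightarrow> lsc_on (adm m) (\<lambda>(x, a). ereal (trans m x a z))"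
    and M3_incr: "\<And>z x y a. z \<in> space (noise m) \<Longrightarrow> (x, a) \<in> adm m \<Longrightarrow> (y, a) \<in> adm m \<Longrightarrow>
            x \<le> y \<Longrightarrow> trans m x a z \<le> trans m y a z"
    and M4_lsc: "lsc_on {(x, a, x'). (x, a) \<in> adm m} (\<lambda>(x, a, x'). ereal (cost m x a x'))"
    and M4_incr: "\<And>x y a x' y'. (x, a) \<in> adm m \<Longrightarrow> (y, a) \<in> adm m \<Longrightarrow>
            x \<le> y \<Longrightarrow> x' \<le> y' \<Longrightarrow> cost m x a x' \<le> cost m y a y'"
  shows
    "(\<forall>N bl bu.
        iid_disturbances m (enat N) \<and>
        (\<forall>\<pi>\<in>policies m (enat N). \<forall>n\<le>N.
            policy_value m \<rho> N n \<pi> \<in> borel_measurable (hist_space m n)) \<and>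
        bounding_pair bl bu \<and>
        (\<forall>\<pi>\<in>policies m (enat N). \<forall>n\<le>N. \<forall>h\<in>space (hist_space m n).
            ereal (bl (snd h)) \<le> policy_value m \<rho> N n \<pi> h \<and>
            policy_value m \<rho> N n \<pi> h \<le> ereal (bu (snd h))) \<and>
        locally_dominated m p (\<lambda>x. bu x - bl x) \<and>
        monetary (prob m) p \<rho> \<and> law_invariant (prob m) p \<rho> \<and> Fatou_property (prob m) p \<rho>
      \<longrightarrow>
        (\<forall>n\<le>N.
            (\<forall>h\<in>space (hist_space m n). opt_value m \<rho> N n h = markov_value m \<rho> N n (snd h)) \<and>
            lsc_on UNIV (markov_value m \<rho> N n) \<and> mono (markov_value m \<rho> N n) \<and>
            (\<forall>x. ereal (bl x) \<le> markov_value m \<rho> N n x \<and>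
                 markov_value m \<rho> N n x \<le> ereal (bu x))) \<and>
        markov_value m \<rho> N N = (\<lambda>_. 0) \<and>
        (\<forall>n<N. markov_value m \<rho> N n = bellman_op m \<rho> (markov_value m \<rho> N (Suc n))) \<and>
        (\<forall>n<N. \<exists>d\<in>markov_rules m.
            bellman_op m \<rho> (markov_value m \<rho> N (Suc n)) =
              rule_op m \<rho> d (markov_value m \<rho> N (Suc n))) \<and>
        (\<forall>d\<in>markov_policies m (enat N).
            (\<forall>n<N. bellman_op m \<rho> (markov_value m \<rho> N (Suc n)) =
                     rule_op m \<rho> (d n) (markov_value m \<rho> N (Suc n))) \<longrightarrow>
            (\<forall>h\<in>space (hist_space m 0).
                policy_value m \<rho> N 0 (as_policy d) h =
                  (INF \<pi>\<in>policies m (enat N). policy_value m \<rho> N 0 \<pi> h))))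
     \<and>
     (\<forall>\<alpha> bl bu.
        iid_disturbances m \<infinity> \<and>
        (\<forall>d\<in>markov_policies m \<infinity>. \<forall>N. J_pol m \<rho> d N \<in> borel_measurable borel) \<and>
        0 \<le> \<alpha> \<and> bounding_pair bl bu \<and>
        (\<forall>(x, a)\<in>adm m.
            ereal (bl x) \<le> \<rho> (\<lambda>w. cost m x a (trans m x a (rep m w))) \<and>
            \<rho> (\<lambda>w. cost m x a (trans m x a (rep m w))) \<le> ereal (bu x) \<and>
            \<rho> (\<lambda>w. - bl (trans m x a (rep m w))) \<le> ereal (- \<alpha> * bl x) \<and>
            \<rho> (\<lambda>w. bu (trans m x a (rep m w))) \<le> ereal (\<alpha> * bu x)) \<and>
        locally_dominated m p (\<lambda>x. bu x - bl x) \<and>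
        law_invariant (prob m) p \<rho> \<and> proper (prob m) p \<rho> \<and> coherent (prob m) p \<rho> \<and>
        Fatou_property (prob m) p \<rho> \<and>
        \<alpha> * discount m < 1
      \<longrightarrow>
        (let I = lsc_incr_between (\<lambda>x. bl x / (1 - \<alpha> * discount m))
                                  (\<lambda>x. bu x / (1 - \<alpha> * discount m)) in
          (\<forall>d\<in>markov_policies m \<infinity>. \<forall>x. (\<lambda>N. J_pol m \<rho> d N x) \<longlonglongrightarrow> J_inf_pol m \<rho> d x) \<and>
          (\<forall>x. (\<lambda>N. J_fin m \<rho> N x) \<longlonglongrightarrow> J_lim m \<rho> x) \<and>
          J_lim m \<rho> \<in> I \<and> bellman_op m \<rho> (J_lim m \<rho>) = J_lim m \<rho> \<and>
          (\<forall>v\<in>I. bellman_op m \<rho> v = v \<longrightarrow> v = J_lim m \<rho>) \<and>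
          (\<exists>d\<in>markov_rules m. rule_op m \<rho> d (J_lim m \<rho>) = bellman_op m \<rho> (J_lim m \<rho>)) \<and>
          (\<forall>d\<in>markov_rules m. rule_op m \<rho> d (J_lim m \<rho>) = bellman_op m \<rho> (J_lim m \<rho>) \<longrightarrow>
              J_inf_pol m \<rho> (\<lambda>_. d) = J_inf m \<rho>) \<and>
          J_inf m \<rho> = J_lim m \<rho>))"
proof (rule conjI; intro allI impI)
  \<comment> \<open>Kept general in the bounds: the infinite horizon uses it for the given bounds
    and again for the rescaled ones.\<close>
  have base: "risk_mdp m p \<rho> bl bu"
    if "bounding_pair bl bu" "locally_dominated m p (\<lambda>x. bu x - bl x)"
      "monetary (prob m) p \<rho>" "Fatou_property (prob m) p \<rho>" for bl bu
    using p model M2_usc M2_decreasing M3_lsc M3_incr M4_lsc M4_incr that by (rule risk_mdp.intro)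
  {
    fix N bl bu
    assume A: "iid_disturbances m (enat N) \<and>
        (\<forall>\<pi>\<in>policies m (enat N). \<forall>n\<le>N.
            policy_value m \<rho> N n \<pi> \<in> borel_measurable (hist_space m n)) \<and>
        bounding_pair bl bu \<and>
        (\<forall>\<pi>\<in>policies m (enat N). \<forall>n\<le>N. \<forall>h\<in>space (hist_space m n).
            ereal (bl (snd h)) \<le> policy_value m \<rho> N n \<pi> h \<and>
            policy_value m \<rho> N n \<pi> h \<le> ereal (bu (snd h))) \<and>
        locally_dominated m p (\<lambda>x. bu x - bl x) \<and>
        monetary (prob m) p \<rho> \<and> law_invariant (prob m) p \<rho> \<and> Fatou_property (prob m) p \<rho>"
      (is "_ \<and> ?meas \<and> ?bp \<and> ?bounds \<and> ?dom \<and> ?mon \<and> _ \<and> ?fat")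
    then have "?meas" "?bp" "?bounds" "?dom" "?mon" "?fat" by blast+
    interpret fh: finite_horizon_mdp m p \<rho> bl bu N
      using base[OF \<open>?bp\<close> \<open>?dom\<close> \<open>?mon\<close> \<open>?fat\<close>] \<open>?meas\<close> \<open>?bounds\<close>
      by (intro finite_horizon_mdp.intro finite_horizon_mdp_axioms.intro) blast+
    note eq = fh.markov_value_eq
    show "(\<forall>n\<le>N.
            (\<forall>h\<in>space (hist_space m n). opt_value m \<rho> N n h = markov_value m \<rho> N n (snd h)) \<and>
            lsc_on UNIV (markov_value m \<rho> N n) \<and> mono (markov_value m \<rho> N n) \<and>
            (\<forall>x. ereal (bl x) \<le> markov_value m \<rho> N n x \<and>
                 markov_value m \<rho> N n x \<le> ereal (bu x))) \<and>
        markov_value m \<rho> N N = (\<lambda>_. 0) \<and>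
        (\<forall>n<N. markov_value m \<rho> N n = bellman_op m \<rho> (markov_value m \<rho> N (Suc n))) \<and>
        (\<forall>n<N. \<exists>d\<in>markov_rules m.
            bellman_op m \<rho> (markov_value m \<rho> N (Suc n)) =
              rule_op m \<rho> d (markov_value m \<rho> N (Suc n))) \<and>
        (\<forall>d\<in>markov_policies m (enat N).
            (\<forall>n<N. bellman_op m \<rho> (markov_value m \<rho> N (Suc n)) =
                     rule_op m \<rho> (d n) (markov_value m \<rho> N (Suc n))) \<longrightarrow>
            (\<forall>h\<in>space (hist_space m 0).
                policy_value m \<rho> N 0 (as_policy d) h =
                  (INF \<pi>\<in>policies m (enat N). policy_value m \<rho> N 0 \<pi> h)))"
    proof (intro conjI allI ballI impI)
      fix n assume n: "n \<le> N"
      note reg = fh.W_regular[OF n, unfolded fh.regular_def lsc_incr_between_def]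
      show "opt_value m \<rho> N n h = markov_value m \<rho> N n (snd h)"
        if "h \<in> space (hist_space m n)" for h
        using fh.opt_value_eq[OF n that] eq[OF n] by simp
      show "lsc_on UNIV (markov_value m \<rho> N n)" "mono (markov_value m \<rho> N n)"
        using reg eq[OF n] by auto
      show "ereal (bl x) \<le> markov_value m \<rho> N n x" "markov_value m \<rho> N n x \<le> ereal (bu x)" for x
        using reg eq[OF n] by auto
    next
      show "markov_value m \<rho> N N = (\<lambda>_. 0)" using eq fh.W_N by simp
    next
      fix n assume n: "n < N"
      show "markov_value m \<rho> N n = bellman_op m \<rho> (markov_value m \<rho> N (Suc n))"
        using n fh.W_rec eq by simp
      obtain d where "d \<in> markov_rules m"
        "rule_op m \<rho> d (fh.W (Suc n)) = bellman_op m \<rho> (fh.W (Suc n))"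
        using fh.minimizer_exists[OF fh.W_regular[of "Suc n"]] n by auto
      then show "\<exists>d\<in>markov_rules m. bellman_op m \<rho> (markov_value m \<rho> N (Suc n)) =
              rule_op m \<rho> d (markov_value m \<rho> N (Suc n))"
        using n eq by (intro bexI[of _ d]) simp_all
    next
      fix d h
      assume d: "d \<in> markov_policies m (enat N)"
        "\<forall>n<N. bellman_op m \<rho> (markov_value m \<rho> N (Suc n)) =
                     rule_op m \<rho> (d n) (markov_value m \<rho> N (Suc n))"
        and h: "h \<in> space (hist_space m 0)"
      have "rule_op m \<rho> (d k) (fh.W (Suc k)) = fh.W k" if "k < N" for k
        using d(2) that eq fh.W_rec by simp
      then have "policy_value m \<rho> N 0 (as_policy d) h = fh.W 0 (snd h)"
        using fh.policy_value_minimizers[OF d(1) _ _ h] by simp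
      also have "\<dots> = opt_value m \<rho> N 0 h" using fh.opt_value_eq[OF _ h] by simp
      finally show "policy_value m \<rho> N 0 (as_policy d) h =
          (INF \<pi>\<in>policies m (enat N). policy_value m \<rho> N 0 \<pi> h)"
        by (simp only: opt_value_def)
    qed
  next
    fix \<alpha> bl bu
    let ?c = "1 / (1 - \<alpha> * discount m)"
    assume A: "iid_disturbances m \<infinity> \<and>
        (\<forall>d\<in>markov_policies m \<infinity>. \<forall>N. J_pol m \<rho> d N \<in> borel_measurable borel) \<and>
        0 \<le> \<alpha> \<and> bounding_pair bl bu \<and>
        (\<forall>(x, a)\<in>adm m.
            ereal (bl x) \<le> \<rho> (\<lambda>w. cost m x a (trans m x a (rep m w))) \<and>
            \<rho> (\<lambda>w. cost m x a (trans m x a (rep m w))) \<le> ereal (bu x) \<and>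
            \<rho> (\<lambda>w. - bl (trans m x a (rep m w))) \<le> ereal (- \<alpha> * bl x) \<and>
            \<rho> (\<lambda>w. bu (trans m x a (rep m w))) \<le> ereal (\<alpha> * bu x)) \<and>
        locally_dominated m p (\<lambda>x. bu x - bl x) \<and>
        law_invariant (prob m) p \<rho> \<and> proper (prob m) p \<rho> \<and> coherent (prob m) p \<rho> \<and>
        Fatou_property (prob m) p \<rho> \<and>
        \<alpha> * discount m < 1"
      (is "_ \<and> ?meas \<and> ?\<alpha> \<and> ?bp \<and> ?bounds \<and> ?dom \<and> _ \<and> _ \<and> ?coh \<and> ?fat \<and> ?\<alpha>\<beta>")
    then have meas: "?meas" and \<alpha>: "?\<alpha>" and bp: "?bp" and bounds: "?bounds" and dom: "?dom"
      and coh: "?coh" and fat: "?fat" and \<alpha>\<beta>: "?\<alpha>\<beta>" by blast+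
    have mon: "monetary (prob m) p \<rho>" using coh by (simp add: coherent_def)
    \<comment> \<open>The given bounds first supply the signs and the L^p membership from which the
      assumptions for the rescaled bounds are checked.\<close>
    interpret base: risk_mdp m p \<rho> bl bu using base[OF bp dom mon fat] .
    have c: "1 \<le> ?c" using \<alpha> \<alpha>\<beta> base.discount by (simp add: field_simps)
    interpret scaled: discounted_mdp m p \<rho> "\<lambda>x. ?c * bl x" "\<lambda>x. ?c * bu x" \<alpha>
    proof (intro discounted_mdp.intro discounted_mdp_axioms.intro)
      show "risk_mdp m p \<rho> (\<lambda>x. ?c * bl x) (\<lambda>x. ?c * bu x)"
        using locally_dominated_scale[OF dom order_trans[OF zero_le_one c]]
        by (intro base bounding_pair_scale[OF bp c] mon fat) (simp add: right_diff_distrib)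
      fix x a assume xa: "(x, a) \<in> adm m"
      show "ereal ((1 - \<alpha> * discount m) * (?c * bl x)) \<le> \<rho> (\<lambda>w. cost m x a (trans m x a (rep m w))) \<and>
        \<rho> (\<lambda>w. cost m x a (trans m x a (rep m w))) \<le> ereal ((1 - \<alpha> * discount m) * (?c * bu x))"
        using bounds xa \<alpha>\<beta> by auto
      \<comment> \<open>Positive homogeneity transfers a growth condition to the rescaled function;
        it is applied to - bl and to bu.\<close>
      have scale: "\<rho> (\<lambda>w. ?c * g (trans m x a (rep m w))) \<le> ereal (\<alpha> * (?c * g x))"
        if "g \<in> borel_measurable borel" "\<And>x. \<bar>g x\<bar> \<le> bu x - bl x"
          "\<rho> (\<lambda>w. g (trans m x a (rep m w))) \<le> ereal (\<alpha> * g x)" for g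
      proof -
        have "\<rho> (\<lambda>w. ?c * g (trans m x a (rep m w))) = ereal ?c * \<rho> (\<lambda>w. g (trans m x a (rep m w)))"
          by (rule coh[unfolded coherent_def, THEN conjunct2, THEN conjunct1, rule_format,
                OF base.state_Lp[OF that(1,2) xa] order_trans[OF zero_le_one c]])
        also have "\<dots> \<le> ereal ?c * ereal (\<alpha> * g x)"
          using that(3) \<alpha>\<beta> by (intro ereal_mult_left_mono) auto
        finally show ?thesis by (simp add: mult_ac)
      qed
      have "- bl y \<le> bu y - bl y" "bu y \<le> bu y - bl y" "bl y \<le> 0" "0 \<le> bu y" for y
        using base.bl_nonpos[of y] base.bu_nonneg[of y] by auto
      then show "\<rho> (\<lambda>w. - (?c * bl (trans m x a (rep m w)))) \<le> ereal (\<alpha> * - (?c * bl x))"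
        and "\<rho> (\<lambda>w. ?c * bu (trans m x a (rep m w))) \<le> ereal (\<alpha> * (?c * bu x))"
        using scale[of "\<lambda>x. - bl x"] scale[of bu] bounds xa base.bl_measurable base.bu_measurable
        by auto
    qed (use \<alpha> \<alpha>\<beta> coh meas in blast)+
    have I: "lsc_incr_between (\<lambda>x. bl x / (1 - \<alpha> * discount m)) (\<lambda>x. bu x / (1 - \<alpha> * discount m))
        = {v. scaled.regular v}"
    proof -
      have "(\<lambda>x. f x / (1 - \<alpha> * discount m)) = (\<lambda>x. ?c * f x)" for f :: "real \<Rightarrow> real" by simp
      from this[of bl] this[of bu] show ?thesis by (simp only: scaled.regular_def Collect_mem_eq)
    qed
    show "let I = lsc_incr_between (\<lambda>x. bl x / (1 - \<alpha> * discount m))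
                                  (\<lambda>x. bu x / (1 - \<alpha> * discount m)) in
          (\<forall>d\<in>markov_policies m \<infinity>. \<forall>x. (\<lambda>N. J_pol m \<rho> d N x) \<longlonglongrightarrow> J_inf_pol m \<rho> d x) \<and>
          (\<forall>x. (\<lambda>N. J_fin m \<rho> N x) \<longlonglongrightarrow> J_lim m \<rho> x) \<and>
          J_lim m \<rho> \<in> I \<and> bellman_op m \<rho> (J_lim m \<rho>) = J_lim m \<rho> \<and>
          (\<forall>v\<in>I. bellman_op m \<rho> v = v \<longrightarrow> v = J_lim m \<rho>) \<and>
          (\<exists>d\<in>markov_rules m. rule_op m \<rho> d (J_lim m \<rho>) = bellman_op m \<rho> (J_lim m \<rho>)) \<and>
          (\<forall>d\<in>markov_rules m. rule_op m \<rho> d (J_lim m \<rho>) = bellman_op m \<rho> (J_lim m \<rho>) \<longrightarrow>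
              J_inf_pol m \<rho> (\<lambda>_. d) = J_inf m \<rho>) \<and>
          J_inf m \<rho> = J_lim m \<rho>"
      unfolding Let_def I
    proof (intro conjI ballI allI impI)
      show "(\<lambda>N. J_pol m \<rho> d N x) \<longlonglongrightarrow> J_inf_pol m \<rho> d x" if "d \<in> markov_policies m \<infinity>" for d x
        by (rule scaled.J_pol_tendsto[OF that])
      show "(\<lambda>N. J_fin m \<rho> N x) \<longlonglongrightarrow> J_lim m \<rho> x" for x
        unfolding scaled.J_fin_eq by (rule scaled.W_tendsto)
      show "J_lim m \<rho> \<in> {v. scaled.regular v}" by (rule CollectI, rule scaled.J_lim_regular)
      show "bellman_op m \<rho> (J_lim m \<rho>) = J_lim m \<rho>" by (rule scaled.J_lim_fixed_point)
      show "v = J_lim m \<rho>" if "v \<in> {v. scaled.regular v}" "bellman_op m \<rho> v = v" for v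
        using that by (intro scaled.fixed_point_unique) (simp_all only: mem_Collect_eq)
      show "\<exists>d\<in>markov_rules m. rule_op m \<rho> d (J_lim m \<rho>) = bellman_op m \<rho> (J_lim m \<rho>)"
        by (rule scaled.minimizer_exists[OF scaled.J_lim_regular], rule bexI)
      show "J_inf_pol m \<rho> (\<lambda>_. d) = J_inf m \<rho>"
        if "d \<in> markov_rules m" "rule_op m \<rho> d (J_lim m \<rho>) = bellman_op m \<rho> (J_lim m \<rho>)" for d
        unfolding scaled.J_inf_eq by (rule scaled.J_inf_pol_stationary[OF that])
      show "J_inf m \<rho> = J_lim m \<rho>" by (rule scaled.J_inf_eq)
    qed
  }
qed

end
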